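(* Let $\vec{A}\subseteq\mathbb{Z}^d$ be a VAS, let $\vec{a}\in\vec{A}$, and let $a=\|\vec{A}\|_\infty$. Every minimal element $\vec{c}$ (for the componentwise order $\leq$) of $\vec{D}_{\vec{a}}$ satisfies $$\|\vec{c}\|_\infty\leq(102d^2a^2)^{(15d^{d+2})^{d+2}}.$$
   Context: A VAS is a finite $\vec{A}\subseteq\mathbb{Z}^d$, $\|\vec{A}\|_\infty=\max_{\vec{a}\in\vec{A}}\max_i|\vec{a}(i)|$ ($0$ if empty), and for $\vec{c}\in\mathbb{N}^d$, $\|\vec{c}\|_\infty=\max_i\vec{c}(i)$. For standard configurations $\vec{x},\vec{y}\in\mathbb{N}^d$ and $\sigma=\vec{a}_1\cdots\vec{a}_k\in\vec{A}^*$, a run $\vec{x}\xrightarrow{\sigma}\vec{y}$ is a sequence $\vec{c}_0,\ldots,\vec{c}_k\in\mathbb{N}^d$ with $\vec{c}_0=\vec{x}$, $\vec{c}_k=\vec{y}$, $\vec{c}_j=\vec{c}_{j-1}+\vec{a}_j$. For $\vec{a}\in\vec{A}$, $\vec{D}_{\vec{a}}$ is the set of $\vec{c}\in\mathbb{N}^d$ for which there exists $\alpha\in\vec{A}^*$ with runs $\vec{c}\xrightarrow{\vec{a}}\vec{c}+\vec{a}\xrightarrow{\alpha}\vec{c}$; it is upward closed for $\leq$. *)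

theory Defs
  imports "HOL-Analysis.Analysis"
begin

text \<open>The dimension d is \<open>CARD('d)\<close>; actions live in \<open>int ^ 'd\<close> and configurations in
  \<open>nat ^ 'd\<close>, where the library order \<open>\<le>\<close> is the componentwise one.\<close>

definition int_vec :: "nat ^ 'd \<Rightarrow> int ^ 'd" where
  "int_vec c = (\<chi> i. int (c $ i))"

definition config_norm :: "nat ^ 'd \<Rightarrow> nat" where
  "config_norm c = Max (range (\<lambda>i. c $ i))"

definition action_norm :: "int ^ 'd \<Rightarrow> nat" where
  "action_norm a = Max (range (\<lambda>i. nat \<bar>a $ i\<bar>))"

text \<open>Meaningful for finite \<open>A\<close> only, since \<open>Max\<close> is unspecified on infinite sets.\<close>
definition vas_norm :: "(int ^ 'd) set \<Rightarrow> nat" where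
  "vas_norm A = (if A = {} then 0 else Max (action_norm ` A))"

definition run :: "nat ^ 'd \<Rightarrow> (int ^ 'd) list \<Rightarrow> nat ^ 'd \<Rightarrow> bool" where
  "run x \<sigma> y \<longleftrightarrow> (\<exists>c :: nat \<Rightarrow> nat ^ 'd. c 0 = x \<and> c (length \<sigma>) = y \<and>
     (\<forall>j < length \<sigma>. int_vec (c (Suc j)) = int_vec (c j) + \<sigma> ! j))"

text \<open>In the set \<open>D\<^sub>a\<close>, the intermediate configuration \<open>c'\<close> is \<open>c + a\<close>: this is what
  \<open>run c [a] c'\<close> says, together with \<open>c + a\<close> being nonnegative.\<close>
definition D_set :: "(int ^ 'd) set \<Rightarrow> int ^ 'd \<Rightarrow> (nat ^ 'd) set" where
  "D_set A a = {c. \<exists>c'. \<exists>\<alpha> \<in> lists A. run c [a] c' \<and> run c' \<alpha> c}"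

definition minimal_in :: "'a::order set \<Rightarrow> 'a \<Rightarrow> bool" where
  "minimal_in S x \<longleftrightarrow> x \<in> S \<and> (\<forall>y \<in> S. y \<le> x \<longrightarrow> y = x)"

end

theory Submission
  imports Defs "HOL-Library.Multiset"
begin

text \<open>Let \<open>c\<close> be minimal and follow a cycle from \<open>c\<close> that begins with \<open>a\<close>. For rapidly growing
  thresholds \<open>b\<^sub>0 \<le> b\<^sub>1 \<le> \<dots>\<close>, take a maximal set \<open>I\<close> of coordinates that stay below \<open>b\<^sub>p\<close>,
  \<open>p = card I\<close>, all along the cycle; every other coordinate then reaches \<open>b\<^bsub>p+1\<^esub>\<close> somewhere. Truncate
  \<open>c\<close> at height \<open>b\<^bsub>p+1\<^esub>\<close>. From the truncation a Rackoff argument raises all coordinates outside \<open>I\<close>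
  simultaneously, and the same holds backwards in time. The two high configurations obtained are
  linked by a run that keeps all coordinates outside \<open>I\<close> high: the projection of the cycle to \<open>I\<close> is
  a strongly connected graph with at most \<open>b\<^sub>p^p\<close> vertices, and because the cycle has displacement
  zero, every edge is undone by a short path of this graph. So the truncation of \<open>c\<close> also lies in
  \<open>D\<^sub>a\<close>, and by minimality it equals \<open>c\<close>.\<close>

section \<open>Zero-sum partitions\<close>

text \<open>Greedy choice: while the partial sum \<open>s\<close> is positive, the zero total forces
  some remaining item to be negative, and adding it keeps the absolute value at most
  \<open>K\<close>; negative \<open>s\<close> is symmetric. The parameter \<open>s\<close> is the
  sum collected so far.\<close>

lemma reorder_bounded_partial_sums:
  fixes w :: "'b \<Rightarrow> int"
  assumes "\<forall>v\<in>#V. \<bar>w v\<bar> \<le> K" "\<bar>s\<bar> \<le> K" "s + (\<Sum>v\<in>#V. w v) = 0"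
  shows "\<exists>l. mset l = V \<and> (\<forall>k\<le>length l. \<bar>s + sum_list (map w (take k l))\<bar> \<le> K)"
  using assms
proof (induction "size V" arbitrary: V s)
  case 0
  then show ?case by auto
next
  case (Suc n)
  have "\<exists>v\<in>#V. \<bar>s + w v\<bar> \<le> K"
  proof (rule ccontr)
    assume neg: "\<not> ?thesis"
    have "V \<noteq> {#}" using Suc.hyps by auto
    then obtain v where v: "v \<in># V" by blast
    consider "s = 0" | "s > 0" | "s < 0" by linarith
    then show False
    proof cases
      case 1
      then show ?thesis using neg Suc.prems v by auto
    next
      case 2
      then have "\<forall>v\<in>#V. w v \<ge> 0" using neg Suc.prems by force
      then have "(\<Sum>v\<in>#V. w v) \<ge> 0" by (induction V) auto
      then show ?thesis using 2 Suc.prems by linarith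
    next
      case 3
      then have "\<forall>v\<in>#V. w v \<le> 0" using neg Suc.prems by force
      then have "(\<Sum>v\<in>#V. w v) \<le> 0" by (induction V) auto
      then show ?thesis using 3 Suc.prems by linarith
    qed
  qed
  then obtain v where v: "v \<in># V" "\<bar>s + w v\<bar> \<le> K" by blast
  then obtain V' where V': "V = add_mset v V'" by (meson multi_member_split)
  have "\<exists>l. mset l = V' \<and> (\<forall>k\<le>length l. \<bar>(s + w v) + sum_list (map w (take k l))\<bar> \<le> K)"
    using Suc.hyps(1)[of V' "s + w v"] Suc.hyps(2) Suc.prems v V' by (simp add: add.assoc)
  then obtain l where l: "mset l = V'"
    "\<forall>k\<le>length l. \<bar>(s + w v) + sum_list (map w (take k l))\<bar> \<le> K" by blast
  show ?case
  proof (intro exI[of _ "v # l"] conjI allI impI)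
    show "mset (v # l) = V" using l V' by simp
    fix k assume "k \<le> length (v # l)"
    then show "\<bar>s + sum_list (map w (take k (v # l)))\<bar> \<le> K"
      using l(2) Suc.prems(2) by (cases k) (auto simp: add.assoc)
  qed
qed

text \<open>After reordering, all partial sums lie among \<open>2 * K + 1\<close> values, so two of
  the prefixes of length at most \<open>2 * K + 1\<close> have the same sum, and the segment between
  them can serve as \<open>g\<close>.\<close>

lemma short_zero_sum_sublist:
  fixes w :: "'b \<Rightarrow> int" and K :: nat
  assumes w: "\<forall>v\<in>set l. \<bar>w v\<bar> \<le> int K" and z: "sum_list (map w l) = 0" and "l \<noteq> []"
  shows "\<exists>g r. mset l = mset (g @ r) \<and> g \<noteq> [] \<and> length g \<le> 2 * K + 1 \<and> sum_list (map w g) = 0"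
proof -
  have "\<exists>l'. mset l' = mset l \<and> (\<forall>k\<le>length l'. \<bar>0 + sum_list (map w (take k l'))\<bar> \<le> int K)"
    using w z by (intro reorder_bounded_partial_sums) (auto simp flip: sum_mset_sum_list)
  then obtain l' where l': "mset l' = mset l"
    "\<forall>k\<le>length l'. \<bar>sum_list (map w (take k l'))\<bar> \<le> int K" by auto
  show ?thesis
  proof (cases "length l' \<le> 2 * K + 1")
    case True
    then show ?thesis using l' z assms(3)
      by (intro exI[of _ l] exI[of _ "[]"]) (auto dest: mset_eq_length)
  next
    case False
    let ?p = "\<lambda>k. sum_list (map w (take k l'))"
    have "?p ` {0..2*K+1} \<subseteq> {- int K..int K}"
    proof clarify
      fix k :: nat assume "k \<in> {0..2*K+1}"
      then have "\<bar>?p k\<bar> \<le> int K" using l'(2) False by simp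
      then show "?p k \<in> {- int K..int K}" by (simp add: abs_le_iff)
    qed
    then have "card (?p ` {0..2*K+1}) \<le> card {- int K..int K}" by (intro card_mono) auto
    also have "\<dots> < card {0..2*K+1}" by simp
    finally have "\<not> inj_on ?p {0..2*K+1}" by (meson pigeonhole)
    then obtain i j where ij: "i < j" "j \<le> 2 * K + 1" "?p i = ?p j"
      unfolding inj_on_def by (metis atLeastAtMost_iff linorder_neqE_nat)
    define g where "g = take (j - i) (drop i l')"
    have tj: "take j l' = take i l' @ g"
      unfolding g_def using ij(1) by (metis le_add_diff_inverse less_imp_le take_add)
    have "l' = take i l' @ g @ drop j l'" using tj by (metis append.assoc append_take_drop_id)
    then have "mset l' = mset (take i l' @ g @ drop j l')" by simp
    then have "mset l' = mset (g @ (take i l' @ drop j l'))" by simp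
    moreover have "sum_list (map w g) = 0" using ij(3) tj by simp
    moreover have "length g = j - i" unfolding g_def using ij False by simp
    ultimately show ?thesis using ij l'(1)
      by (intro exI[of _ g] exI[of _ "take i l' @ drop j l'"]) auto
  qed
qed

lemma zero_sum_partition_int:
  fixes w :: "'b \<Rightarrow> int" and K :: nat
  assumes "\<forall>v\<in>set l. \<bar>w v\<bar> \<le> int K" "sum_list (map w l) = 0"
  shows "\<exists>gs. mset (concat gs) = mset l \<and>
    (\<forall>g\<in>set gs. length g \<le> 2 * K + 1 \<and> sum_list (map w g) = 0)"
  using assms
proof (induction "length l" arbitrary: l rule: less_induct)
  case less
  show ?case
  proof (cases "l = []")
    case True
    then show ?thesis by (intro exI[of _ "[]"]) auto
  next
    case False
    then obtain g r where gr: "mset l = mset (g @ r)" "g \<noteq> []" "length g \<le> 2 * K + 1"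
      "sum_list (map w g) = 0"
      using short_zero_sum_sublist less.prems by blast
    have "sum_list (map w l) = sum_list (map w g) + sum_list (map w r)"
      using gr(1) by (metis map_append sum_list_append mset_map sum_mset_sum_list)
    moreover have "set r \<subseteq> set l" using gr(1) by (metis set_append set_mset_mset Un_upper2)
    moreover have "length r < length l" using gr(1,2) by (metis length_append length_greater_0_conv
          less_add_same_cancel2 mset_eq_length)
    ultimately have "\<exists>gs. mset (concat gs) = mset r \<and>
        (\<forall>g\<in>set gs. length g \<le> 2 * K + 1 \<and> sum_list (map w g) = 0)"
      using less.prems gr by (intro less.hyps) auto
    then obtain gs where "mset (concat gs) = mset r"
        "\<forall>g\<in>set gs. length g \<le> 2 * K + 1 \<and> sum_list (map w g) = 0" by blast
    then show ?thesis using gr by (intro exI[of _ "g # gs"]) auto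
  qed
qed

text \<open>Groups that cancel in \<open>k\<close> coordinates weigh at most \<open>K\<close> times
  their length in the next one, so at most \<open>2 * K * group_bound K k + 1\<close> of them are
  merged into a group that cancels there too.\<close>

primrec group_bound :: "nat \<Rightarrow> nat \<Rightarrow> nat" where
  "group_bound K 0 = 1"
| "group_bound K (Suc k) = group_bound K k * (2 * K * group_bound K k + 1)"

lemma group_bound_pos: "group_bound K k \<ge> 1"
  by (induction k) auto

text \<open>The factor \<open>3 * K\<close> turns the recursion into squaring, because
  \<open>2 * K * G + 1 \<le> 3 * K * G\<close> for positive \<open>K\<close> and
  \<open>G\<close>.\<close>

lemma group_bound_le:
  assumes "K \<ge> 1"
  shows "3 * K * group_bound K k \<le> (3 * K) ^ (2 ^ k)"
proof (induction k)
  case (Suc k)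
  have "2 * K * group_bound K k + 1 \<le> 3 * K * group_bound K k"
    using assms group_bound_pos[of K k] by (simp add: mult_ge1_I)
  then have "3 * K * group_bound K (Suc k) \<le> (3 * K * group_bound K k) * (3 * K * group_bound K k)"
    by simp
  also have "\<dots> \<le> (3 * K) ^ (2 ^ k) * (3 * K) ^ (2 ^ k)"
    using Suc by (intro mult_mono) auto
  also have "\<dots> = (3 * K) ^ (2 ^ Suc k)" by (simp only: power_add[symmetric] power_Suc mult_2)
  finally show ?case .
qed simp

lemma abs_sum_list_le:
  fixes w :: "'b \<Rightarrow> int"
  assumes "\<forall>v\<in>set l. \<bar>w v\<bar> \<le> K"
  shows "\<bar>sum_list (map w l)\<bar> \<le> int (length l) * K"
  using assms by (induction l) (auto simp: algebra_simps)

lemma length_concat_le: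
  assumes "\<forall>g\<in>set gs. length g \<le> n"
  shows "length (concat gs) \<le> length gs * n"
  using assms by (induction gs) auto

lemma sum_list_map_concat:
  "sum_list (map w (concat gs)) = sum_list (map (\<lambda>g. sum_list (map w g)) gs)"
  by (induction gs) auto

lemma mset_concat_cong: "mset xs = mset ys \<Longrightarrow> mset (concat xs) = mset (concat ys)"
  by (metis mset_concat mset_map sum_mset_sum_list)

lemma sum_list_mset_cong:
  fixes w :: "'b \<Rightarrow> 'c::comm_monoid_add"
  shows "mset xs = mset ys \<Longrightarrow> sum_list (map w xs) = sum_list (map w ys)"
  by (metis mset_map sum_mset_sum_list)

lemma concat_map_concat: "concat (map concat hs) = concat (concat hs)"
  by (induction hs) auto

text \<open>Coordinates are treated one at a time: the groups that already cancel on
  \<open>D\<close> become the items of the one-dimensional partition for the new coordinate. What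
  matters later is that the group length is independent of the length of \<open>l\<close>.\<close>

lemma zero_sum_partition:
  fixes w :: "'b \<Rightarrow> 'c \<Rightarrow> int" and K :: nat
  assumes "finite D" "\<forall>v\<in>set l. \<forall>i\<in>D. \<bar>w v i\<bar> \<le> int K"
    "\<forall>i\<in>D. sum_list (map (\<lambda>v. w v i) l) = 0"
  shows "\<exists>gs. mset (concat gs) = mset l \<and> (\<forall>g\<in>set gs. length g \<le> group_bound K (card D) \<and>
    (\<forall>i\<in>D. sum_list (map (\<lambda>v. w v i) g) = 0))"
  using assms
proof (induction D rule: finite_induct)
  case empty
  have "concat (map (\<lambda>v. [v]) l) = l" by (induction l) auto
  then show ?case by (intro exI[of _ "map (\<lambda>v. [v]) l"]) auto
next
  case (insert i D)
  let ?B = "group_bound K (card D)"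
  from insert obtain gs where gs: "mset (concat gs) = mset l"
    "\<forall>g\<in>set gs. length g \<le> ?B \<and> (\<forall>i\<in>D. sum_list (map (\<lambda>v. w v i) g) = 0)"
    by auto
  let ?w = "\<lambda>g. sum_list (map (\<lambda>v. w v i) g)"
  have sub: "set (concat gs) = set l" using gs(1) by (metis set_mset_mset)
  have "\<forall>g\<in>set gs. \<bar>?w g\<bar> \<le> int (K * ?B)"
  proof
    fix g assume g: "g \<in> set gs"
    then have "set g \<subseteq> set l" using sub by auto
    then have "\<bar>?w g\<bar> \<le> int (length g) * int K"
      using insert.prems by (intro abs_sum_list_le) auto
    also have "\<dots> \<le> int ?B * int K" using gs g by (intro mult_right_mono) auto
    finally show "\<bar>?w g\<bar> \<le> int (K * ?B)" by (simp add: mult.commute)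
  qed
  moreover have "sum_list (map ?w gs) = 0"
    using insert.prems(2) sum_list_mset_cong[OF gs(1)] by (metis insertI1 sum_list_map_concat)
  ultimately obtain hs where hs: "mset (concat hs) = mset gs"
    "\<forall>h\<in>set hs. length h \<le> 2 * (K * ?B) + 1 \<and> sum_list (map ?w h) = 0"
    using zero_sum_partition_int[where w = ?w and l = gs and K = "K * ?B"] by blast
  have sub2: "set (concat hs) = set gs" using hs(1) by (metis set_mset_mset)
  show ?case
  proof (intro exI[of _ "map concat hs"] conjI ballI)
    show "mset (concat (map concat hs)) = mset l"
      using mset_concat_cong[OF hs(1)] gs(1) by (simp only: concat_map_concat)
  next
    fix g assume "g \<in> set (map concat hs)"
    then obtain h where h: "h \<in> set hs" "g = concat h" by auto
    have hg: "set h \<subseteq> set gs" using h sub2 by auto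
    have "length g \<le> length h * ?B" unfolding h(2) using hg gs(2) by (intro length_concat_le) auto
    also have "\<dots> \<le> (2 * (K * ?B) + 1) * ?B" using hs(2) h by (intro mult_right_mono) auto
    finally show "length g \<le> group_bound K (card (insert i D))"
      using insert.hyps by (simp add: algebra_simps)
    fix j assume j: "j \<in> insert i D"
    show "sum_list (map (\<lambda>v. w v j) g) = 0"
    proof (cases "j = i")
      case True
      then show ?thesis using h hs(2) by (simp add: sum_list_map_concat)
    next
      case False
      have "\<forall>q\<in>set h. sum_list (map (\<lambda>v. w v j) q) = 0"
        using hg gs(2) j False by auto
      then have "sum_list (map (\<lambda>q. sum_list (map (\<lambda>v. w v j) q)) h) = 0"
        by (induction h) auto
      then show ?thesis unfolding h(2) sum_list_map_concat .
    qed
  qed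
qed

text \<open>Peel off \<open>W\<close> clamped to \<open>[-\<kappa>, \<kappa>]\<close> in every
  coordinate; the remainder keeps its signs and vanishes after at most \<open>r\<close> rounds. The
  pieces serve as fillers in \<open>steer\<close>.\<close>

lemma clamp_decomposition:
  fixes W :: "int ^ 'd" and \<kappa> :: nat
  assumes "\<forall>i. \<bar>W $ i\<bar> \<le> int r * int \<kappa>"
  shows "\<exists>fs. sum_list fs = W \<and> (\<forall>f\<in>set fs. \<forall>i. \<bar>f $ i\<bar> \<le> int \<kappa> \<and>
    (W $ i \<ge> 0 \<longrightarrow> f $ i \<ge> 0) \<and> (W $ i \<le> 0 \<longrightarrow> f $ i \<le> 0))"
  using assms
proof (induction r arbitrary: W)
  case 0
  then have "W = 0" by (simp add: vec_eq_iff)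
  then show ?case by (intro exI[of _ "[]"]) auto
next
  case (Suc r)
  define f :: "int ^ 'd" where "f = (\<chi> i. max (- int \<kappa>) (min (int \<kappa>) (W $ i)))"
  have f: "f $ i = max (- int \<kappa>) (min (int \<kappa>) (W $ i))" for i by (simp add: f_def)
  have "\<bar>(W - f) $ i\<bar> \<le> int r * int \<kappa>" for i
  proof -
    have "\<bar>W $ i\<bar> \<le> int r * int \<kappa> + int \<kappa>" using Suc.prems[rule_format, of i] by (simp add: algebra_simps)
    moreover have "0 \<le> int r * int \<kappa>" by simp
    ultimately show ?thesis unfolding vector_minus_component f by linarith
  qed
  then obtain fs where fs: "sum_list fs = W - f" "\<forall>g\<in>set fs. \<forall>i. \<bar>g $ i\<bar> \<le> int \<kappa> \<and>
    ((W - f) $ i \<ge> 0 \<longrightarrow> g $ i \<ge> 0) \<and> ((W - f) $ i \<le> 0 \<longrightarrow> g $ i \<le> 0)"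
    using Suc.IH[of "W - f"] by blast
  have sg: "W $ i \<ge> 0 \<Longrightarrow> (W - f) $ i \<ge> 0" "W $ i \<le> 0 \<Longrightarrow> (W - f) $ i \<le> 0" for i
    unfolding vector_minus_component f by linarith+
  have fi: "\<bar>f $ i\<bar> \<le> int \<kappa>" "W $ i \<ge> 0 \<Longrightarrow> f $ i \<ge> 0" "W $ i \<le> 0 \<Longrightarrow> f $ i \<le> 0" for i
    unfolding f by linarith+
  show ?case
    by (intro exI[of _ "f # fs"]) (use fs sg fi in auto)
qed

section \<open>Walks in the projection of a cyclic run\<close>

text \<open>\<open>restrict\<close> fixes the values outside \<open>S\<close>, so equality of
  projections is agreement on \<open>S\<close>, and bounded projections lie in a finite extensional
  function space.\<close>

definition proj :: "(int \<Rightarrow> int ^ 'd) \<Rightarrow> 'd set \<Rightarrow> int \<Rightarrow> 'd \<Rightarrow> int" where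
  "proj x S t = restrict (\<lambda>i. x t $ i) S"

text \<open>The edge \<open>t\<close> leads from the vertex of time \<open>t\<close> to that of time
  \<open>t + 1\<close>. Consecutive edges have to match in projection only, so a walk may jump
  between different times.\<close>

primrec walk :: "(int \<Rightarrow> int ^ 'd) \<Rightarrow> 'd set \<Rightarrow> int \<Rightarrow> int list \<Rightarrow> int \<Rightarrow> bool" where
  "walk x S p [] q \<longleftrightarrow> proj x S p = proj x S q"
| "walk x S p (t # ts) q \<longleftrightarrow> proj x S p = proj x S t \<and> walk x S (t + 1) ts q"

definition disp :: "(int \<Rightarrow> int ^ 'd) \<Rightarrow> int list \<Rightarrow> int ^ 'd" where
  "disp \<alpha> ts = sum_list (map \<alpha> ts)"

text \<open>In contrast to \<open>walk\<close>, the word is fired from an arbitrary vector, and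
  every coordinate has to stay nonnegative throughout.\<close>

primrec exec :: "(int \<Rightarrow> int ^ 'd) \<Rightarrow> int ^ 'd \<Rightarrow> int list \<Rightarrow> bool" where
  "exec \<alpha> y [] \<longleftrightarrow> (\<forall>i. 0 \<le> y $ i)"
| "exec \<alpha> y (t # ts) \<longleftrightarrow> (\<forall>i. 0 \<le> y $ i) \<and> exec \<alpha> (y + \<alpha> t) ts"

lemma proj_eq_iff: "proj x S p = proj x S q \<longleftrightarrow> (\<forall>i\<in>S. x p $ i = x q $ i)"
  unfolding proj_def by (metis restrict_apply restrict_ext)

lemma disp_simps [simp]:
  "disp \<alpha> [] = 0" "disp \<alpha> (t # ts) = \<alpha> t + disp \<alpha> ts" "disp \<alpha> (us @ ts) = disp \<alpha> us + disp \<alpha> ts"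
  by (simp_all add: disp_def)

lemma disp_concat: "disp \<alpha> (concat ls) = sum_list (map (disp \<alpha>) ls)"
  by (induction ls) auto

lemma walk_cong_start: "proj x S p = proj x S p' \<Longrightarrow> walk x S p ts q \<longleftrightarrow> walk x S p' ts q"
  by (cases ts) auto

lemma walk_cong_end: "proj x S q = proj x S q' \<Longrightarrow> walk x S p ts q \<longleftrightarrow> walk x S p ts q'"
  by (induction ts arbitrary: p) auto

lemma walk_append: "walk x S p (us @ ts) q \<longleftrightarrow> (\<exists>r. walk x S p us r \<and> walk x S r ts q)"
proof (induction us arbitrary: p)
  case Nil
  then show ?case by (metis append_Nil walk.simps(1) walk_cong_start)
qed auto

lemma walk_appendI: "walk x S p us r \<Longrightarrow> walk x S r ts q \<Longrightarrow> walk x S p (us @ ts) q"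
  using walk_append by blast

lemma walk_append_Cons: "walk x S p (us @ t # ts) q \<longleftrightarrow> walk x S p us t \<and> walk x S t (t # ts) q"
  unfolding walk_append walk.simps using walk_cong_end[of x S _ t] by blast

lemma walk_concat:
  "(\<And>l. l \<in> set ls \<Longrightarrow> walk x S p l p) \<Longrightarrow> walk x S p (concat ls) p"
  by (induction ls) (auto intro: walk_appendI)

lemma walk_mono: "walk x S p ts q \<Longrightarrow> I \<subseteq> S \<Longrightarrow> walk x I p ts q"
  by (induction ts arbitrary: p) (auto simp: proj_eq_iff)

lemma exec_nonneg: "exec \<alpha> y ts \<Longrightarrow> 0 \<le> y $ i"
  by (cases ts) auto

lemma exec_append: "exec \<alpha> y (us @ ts) \<longleftrightarrow> exec \<alpha> y us \<and> exec \<alpha> (y + disp \<alpha> us) ts"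
  by (induction us arbitrary: y) (auto simp: exec_nonneg add.assoc)

text \<open>The sources of the first \<open>N + 1\<close> edges are among at most \<open>N\<close>
  vertices, so two coincide and the edges between them form a loop. Its base vertex is represented
  by its first edge \<open>hd l\<close>.\<close>

lemma walk_excise_loop:
  assumes "walk x S p ts q" "card (proj x S ` set ts) \<le> N" "length ts > N"
  shows "\<exists>us l vs. ts = us @ l @ vs \<and> l \<noteq> [] \<and> length l \<le> N \<and>
    walk x S p (us @ vs) q \<and> walk x S (hd l) l (hd l)"
proof -
  have "(\<lambda>k. proj x S (ts ! k)) ` {0..N} \<subseteq> proj x S ` set ts" using assms(3) by auto
  then have "card ((\<lambda>k. proj x S (ts ! k)) ` {0..N}) \<le> card (proj x S ` set ts)"
    by (intro card_mono) auto
  also have "\<dots> < card {0..N}" using assms(2) by simp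
  finally have "\<not> inj_on (\<lambda>k. proj x S (ts ! k)) {0..N}" by (meson pigeonhole)
  then obtain i j where ij: "i < j" "j \<le> N" "proj x S (ts ! i) = proj x S (ts ! j)"
    unfolding inj_on_def by (metis atLeastAtMost_iff linorder_neqE_nat)
  define us where "us = take i ts"
  define l where "l = take (j - i) (drop i ts)"
  define vs where "vs = drop j ts"
  have tj: "take j ts = us @ l"
    unfolding us_def l_def using ij(1) by (metis le_add_diff_inverse less_imp_le take_add)
  have ts: "ts = us @ l @ vs" unfolding vs_def using tj by (metis append.assoc append_take_drop_id)
  have len: "length l = j - i" unfolding l_def using ij assms(3) by simp
  have "drop i ts = ts ! i # drop (Suc i) ts" using ij assms(3) by (simp add: Cons_nth_drop_Suc)
  then have l: "l = ts ! i # take (j - i - 1) (drop (Suc i) ts)"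
    unfolding l_def using ij(1) by (simp add: take_Cons')
  have hl: "hd l = ts ! i" by (subst l) simp
  obtain vs' where vs: "vs = ts ! j # vs'"
    unfolding vs_def using ij assms(3) by (metis Cons_nth_drop_Suc le_less_trans)
  have w: "walk x S p us (ts ! i)" "walk x S (ts ! i) (l @ vs) q"
    using assms(1) ts l walk_append_Cons by (metis append_Cons)+
  then have w2: "walk x S (ts ! i) l (ts ! j)" "walk x S (ts ! j) vs q"
    using vs walk_append_Cons by metis+
  have "walk x S p us (ts ! j)" using w(1) ij(3) walk_cong_end by blast
  then have "walk x S p (us @ vs) q" using w2 walk_appendI by blast
  moreover have "walk x S (hd l) l (hd l)" using w2(1) walk_cong_end[OF ij(3)] unfolding hl by simp
  moreover have "l \<noteq> []" by (subst l) simp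
  moreover have "length l \<le> N" using len ij by simp
  ultimately show ?thesis using ts by blast
qed

text \<open>Excise loops repeatedly. They are recorded rather than discarded, so that the total
  displacement remains accounted for.\<close>

lemma walk_decompose:
  assumes "walk x S p ts q" "card (proj x S ` set ts) \<le> N"
  shows "\<exists>us ls. walk x S p us q \<and> length us \<le> N \<and> set us \<subseteq> set ts \<and>
    (\<forall>l\<in>set ls. length l \<le> N \<and> walk x S (hd l) l (hd l)) \<and>
    disp \<alpha> ts = disp \<alpha> us + sum_list (map (disp \<alpha>) ls)"
  using assms
proof (induction "length ts" arbitrary: ts rule: less_induct)
  case less
  show ?case
  proof (cases "length ts \<le> N")
    case True
    then show ?thesis using less.prems by (intro exI[of _ ts] exI[of _ "[]"]) auto
  next
    case False
    then obtain us l vs where *: "ts = us @ l @ vs" "l \<noteq> []" "length l \<le> N"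
      "walk x S p (us @ vs) q" "walk x S (hd l) l (hd l)"
      using walk_excise_loop[OF less.prems] by auto
    have "card (proj x S ` set (us @ vs)) \<le> card (proj x S ` set ts)"
      unfolding *(1) by (intro card_mono) auto
    then obtain us' ls where "walk x S p us' q" "length us' \<le> N" "set us' \<subseteq> set (us @ vs)"
       "\<forall>l\<in>set ls. length l \<le> N \<and> walk x S (hd l) l (hd l)"
       "disp \<alpha> (us @ vs) = disp \<alpha> us' + sum_list (map (disp \<alpha>) ls)"
      using less.hyps[of "us @ vs"] * less.prems(2) by auto
    then show ?thesis using * by (intro exI[of _ us'] exI[of _ "l # ls"]) (auto simp: algebra_simps)
  qed
qed

lemma exec_concat:
  assumes "\<And>us g vs. gs = us @ g # vs \<Longrightarrow> exec \<alpha> (y + disp \<alpha> (concat us)) g"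
    and "exec \<alpha> (y + disp \<alpha> (concat gs)) []"
  shows "exec \<alpha> y (concat gs)"
  using assms
proof (induction gs arbitrary: y)
  case Nil
  then show ?case by simp
next
  case (Cons g gs)
  have "exec \<alpha> y g" using Cons.prems(1)[of "[]" g gs] by simp
  moreover have "exec \<alpha> (y + disp \<alpha> g) (concat gs)"
  proof (rule Cons.IH)
    fix us h vs assume "gs = us @ h # vs"
    then show "exec \<alpha> (y + disp \<alpha> g + disp \<alpha> (concat us)) h"
      using Cons.prems(1)[of "g # us" h vs] by (simp add: add.assoc)
  qed (use Cons.prems(2) in \<open>simp add: add.assoc\<close>)
  ultimately show ?case by (simp add: exec_append)
qed

text \<open>The function \<open>x\<close> is a cyclic run traversed periodically, with times in both directions so that
  the time reversal of a cyclic run is again one. Words are lists of times \<open>t\<close>, standing for the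
  actions \<open>\<alpha> t\<close>, and a vertex of the graph obtained by projecting the run to the coordinates in
  \<open>S\<close> is represented by any time at which it is visited.\<close>

locale cyclic_run =
  fixes x \<alpha> :: "int \<Rightarrow> int ^ 'd" and n :: int and m :: nat
  assumes step: "x (t + 1) = x t + \<alpha> t"
    and periodic: "x (t + n) = x t"
    and period_pos: "n > 0"
    and nonneg: "0 \<le> x t $ i"
    and action_le: "\<bar>\<alpha> t $ i\<bar> \<le> int m"
begin

lemma periodic_nat: "x (t + int k * n) = x t"
proof (induction k)
  case (Suc k)
  have "x (t + int (Suc k) * n) = x (t + int k * n + n)" by (simp add: algebra_simps)
  then show ?case using Suc periodic by simp
qed simp

text \<open>Add a multiple of the period. This is the source of strong connectivity: from any time
  on, the run still meets every vertex.\<close>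

lemma ex_later: "\<exists>s\<ge>u. x s = x t"
proof -
  have "n * \<bar>u - t\<bar> \<ge> \<bar>u - t\<bar>" using period_pos by (simp add: mult_le_cancel_right1)
  then have "t + int (nat \<bar>u - t\<bar>) * n \<ge> u" by (simp add: mult.commute)
  then show ?thesis using periodic_nat by blast
qed

lemma walk_disp: "walk x S p ts q \<Longrightarrow> i \<in> S \<Longrightarrow> x q $ i = x p $ i + disp \<alpha> ts $ i"
  by (induction ts arbitrary: p) (auto simp: proj_eq_iff step)

lemma disp_le: "\<bar>disp \<alpha> ts $ i\<bar> \<le> int (m * length ts)"
proof (induction ts)
  case (Cons t ts)
  then show ?case using action_le[of t i] by (simp add: algebra_simps)
qed simp

text \<open>On \<open>S\<close> the configuration follows the nonnegative run; elsewhere each action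
  costs at most \<open>m\<close>, so a reserve of \<open>m\<close> per letter suffices.\<close>

lemma exec_walk:
  assumes "walk x S p ts q" "\<forall>i\<in>S. y $ i = x p $ i" "\<forall>i. i \<notin> S \<longrightarrow> y $ i \<ge> int (m * length ts)"
  shows "exec \<alpha> y ts"
  using assms
proof (induction ts arbitrary: p y)
  case Nil
  then show ?case using nonneg by (metis exec.simps(1) list.size(3) mult_0_right of_nat_0)
next
  case (Cons t ts)
  have "0 \<le> y $ i" for i
    using Cons.prems(2,3) nonneg by (metis of_nat_0_le_iff order_trans)
  moreover have "exec \<alpha> (y + \<alpha> t) ts"
  proof (rule Cons.IH)
    show "walk x S (t + 1) ts q" using Cons.prems by simp
    show "\<forall>i\<in>S. (y + \<alpha> t) $ i = x (t + 1) $ i" using Cons.prems by (auto simp: proj_eq_iff step)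
    have "(y + \<alpha> t) $ i \<ge> int (m * length ts)" if "i \<notin> S" for i
      using Cons.prems(3)[rule_format, OF that] action_le[of t i] by (simp add: algebra_simps)
    then show "\<forall>i. i \<notin> S \<longrightarrow> (y + \<alpha> t) $ i \<ge> int (m * length ts)" by blast
  qed
  ultimately show ?case by simp
qed

lemma walk_upto: "p \<le> q \<Longrightarrow> walk x S p [p..q - 1] q"
proof (induction "nat (q - p)" arbitrary: p)
  case 0
  then show ?case by simp
next
  case (Suc k)
  then have "walk x S (p + 1) [p + 1..q - 1] q" by (intro Suc.hyps) auto
  then show ?case using Suc by (simp add: upto_rec1)
qed

lemma disp_upto: "p \<le> q \<Longrightarrow> disp \<alpha> [p..q - 1] = x q - x p"
proof (induction "nat (q - p)" arbitrary: p)
  case 0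
  then show ?case by simp
next
  case (Suc k)
  then have "disp \<alpha> [p + 1..q - 1] = x q - x (p + 1)" by (intro Suc.hyps) auto
  then show ?case using Suc by (simp add: upto_rec1 step)
qed

lemma card_proj_le:
  assumes "\<And>t i. t \<in> T \<Longrightarrow> i \<in> S \<Longrightarrow> x t $ i < int b"
  shows "finite (proj x S ` T)" "card (proj x S ` T) \<le> b ^ card S"
proof -
  have sub: "proj x S ` T \<subseteq> S \<rightarrow>\<^sub>E {0..<int b}" using assms nonneg by (auto simp: proj_def)
  have fin: "finite (S \<rightarrow>\<^sub>E {0..<int b})" by (intro finite_PiE) auto
  show "finite (proj x S ` T)" using sub fin by (rule finite_subset)
  show "card (proj x S ` T) \<le> b ^ card S"
    using card_mono[OF fin sub] by (simp add: card_PiE)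
qed

end

section \<open>Raising coordinates and inverting steps\<close>

text \<open>Here \<open>p\<close> is \<open>card I\<close> and \<open>k\<close> counts the
  coordinates of \<open>S\<close> outside \<open>I\<close>. A shortened walk below height
  \<open>h\<close> on \<open>p + Suc k\<close> coordinates has at most
  \<open>h ^ (p + Suc k)\<close> edges; the second summand is the reserve that keeps the other
  coordinates at \<open>h\<close> afterwards.\<close>

primrec escape_bound :: "nat \<Rightarrow> nat \<Rightarrow> nat \<Rightarrow> nat \<Rightarrow> nat" where
  "escape_bound m p H 0 = H"
| "escape_bound m p H (Suc k) = escape_bound m p H k + m * escape_bound m p H k ^ (p + Suc k)"

lemma escape_bound_mono: "j \<le> k \<Longrightarrow> escape_bound m p H j \<le> escape_bound m p H k"
  by (rule lift_Suc_mono_le[of "escape_bound m p H"]) auto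

context cyclic_run
begin

text \<open>Rackoff's argument: follow the run until a coordinate of \<open>S - I\<close> gets high, with loops
  in the projection to \<open>S\<close> removed; this path is too short to spoil the coordinates that are
  already high, and the new one can be dropped from \<open>S\<close>.\<close>

lemma pump_up:
  assumes "I \<subseteq> S" "card S = card I + k"
    and "\<And>t i. i \<in> I \<Longrightarrow> x t $ i < int H"
    and "\<And>i. i \<notin> I \<Longrightarrow> \<exists>t. x t $ i \<ge> int M"
    and "escape_bound m (card I) H k \<le> M"
    and "\<And>i. i \<in> S \<Longrightarrow> y $ i = x p $ i"
    and "\<And>i. i \<notin> S \<Longrightarrow> y $ i \<ge> int (escape_bound m (card I) H k)"
  shows "\<exists>ts q. walk x I p ts q \<and> exec \<alpha> y ts \<and> (\<forall>i. i \<notin> I \<longrightarrow> (y + disp \<alpha> ts) $ i \<ge> int H)"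
  using assms
proof (induction k arbitrary: S y p)
  case 0
  have "S = I" using "0.prems"(1,2) by (metis add_0_right card_subset_eq finite_class.finite)
  moreover have "0 \<le> y $ i" for i
  proof (cases "i \<in> S")
    case False
    then show ?thesis using "0.prems"(7)[of i] by simp
  qed (use "0.prems"(6) nonneg in simp)
  ultimately show ?case using "0.prems"(7) by (intro exI[of _ "[]"] exI[of _ p]) auto
next
  case (Suc k)
  define h where "h = escape_bound m (card I) H k"
  have hS: "escape_bound m (card I) H (Suc k) = h + m * h ^ card S"
    using Suc.prems(2) by (simp add: h_def)
  have Hh: "H \<le> h" unfolding h_def using escape_bound_mono[of 0 k m "card I" H] by simp
  have hM: "h \<le> M" using Suc.prems(5) unfolding hS by simp
  have "S \<noteq> I" using Suc.prems(2) by auto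
  then obtain i where i: "i \<in> S" "i \<notin> I" using Suc.prems(1) by blast
  \<comment> \<open>The least such \<open>e\<close> marks the first time from \<open>p\<close> on at
    which a coordinate of \<open>S\<close> reaches \<open>h\<close>. It exists because
    \<open>i\<close> reaches \<open>M\<close>, which is at least \<open>h\<close>, and periodicity
    moves this event past \<open>p\<close>.\<close>
  define P where "P e \<longleftrightarrow> (\<exists>j\<in>S. x (p + int e) $ j \<ge> int h)" for e
  obtain t where "x t $ i \<ge> int M" using Suc.prems(4) i by blast
  then obtain s where "s \<ge> p" "x s $ i \<ge> int M" using ex_later by metis
  then have "P (nat (s - p))" unfolding P_def using i hM by force
  then obtain e where e: "P e" "\<And>e'. e' < e \<Longrightarrow> \<not> P e'" by (metis LeastI not_less_Least)
  define q where "q = p + int e"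
  obtain j where j: "j \<in> S" "x q $ j \<ge> int h" using e(1) unfolding P_def q_def by blast
  have jI: "j \<notin> I" using Suc.prems(3)[of j q] j(2) Hh by auto
  \<comment> \<open>By the choice of \<open>e\<close>, the segment before \<open>q\<close> meets at
    most \<open>h ^ card S\<close> vertices and can be shortened to that length.\<close>
  have "x t $ l < int h" if "t \<in> set [p..q - 1]" "l \<in> S" for t l
  proof -
    have "p + int (nat (t - p)) = t" "nat (t - p) < e" using that unfolding q_def by auto
    then have "\<not> x t $ l \<ge> int h" using e(2)[of "nat (t - p)"] that(2) unfolding P_def by auto
    then show ?thesis by simp
  qed
  then have "card (proj x S ` set [p..q - 1]) \<le> h ^ card S" by (rule card_proj_le)
  moreover have "walk x S p [p..q - 1] q" unfolding q_def by (intro walk_upto) auto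
  ultimately obtain us where us: "walk x S p us q" "length us \<le> h ^ card S"
    using walk_decompose by blast
  define y' where "y' = y + disp \<alpha> us"
  have us': "m * length us \<le> m * h ^ card S" using us(2) by simp
  have ex: "exec \<alpha> y us"
  proof (rule exec_walk[OF us(1)])
    show "\<forall>i\<in>S. y $ i = x p $ i" using Suc.prems(6) by blast
    show "\<forall>i. i \<notin> S \<longrightarrow> y $ i \<ge> int (m * length us)"
    proof (intro allI impI)
      fix i assume "i \<notin> S"
      then have "y $ i \<ge> int (h + m * h ^ card S)" using Suc.prems(7) hS by metis
      then show "y $ i \<ge> int (m * length us)" using us' by linarith
    qed
  qed
  have "\<exists>ts r. walk x I q ts r \<and> exec \<alpha> y' ts \<and> (\<forall>i. i \<notin> I \<longrightarrow> (y' + disp \<alpha> ts) $ i \<ge> int H)"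
  proof (rule Suc.IH[of "S - {j}"])
    show "I \<subseteq> S - {j}" using Suc.prems(1) jI by blast
    show "card (S - {j}) = card I + k" using Suc.prems(2) j(1) by simp
    show "escape_bound m (card I) H k \<le> M" using hM h_def by simp
    have y'S: "y' $ l = x q $ l" if "l \<in> S" for l
      using walk_disp[OF us(1) that] Suc.prems(6)[OF that] unfolding y'_def by simp
    then show "y' $ l = x q $ l" if "l \<in> S - {j}" for l using that by blast
    fix l assume l: "l \<notin> S - {j}"
    show "y' $ l \<ge> int (escape_bound m (card I) H k)"
    proof (cases "l = j")
      case True
      then show ?thesis using y'S j h_def by simp
    next
      case False
      then have "l \<notin> S" using l by blast
      then have "y $ l \<ge> int (h + m * h ^ card S)" using Suc.prems(7)[of l] unfolding hS by blast
      moreover have "\<bar>disp \<alpha> us $ l\<bar> \<le> int (m * length us)" by (rule disp_le)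
      ultimately show ?thesis using us' unfolding y'_def h_def[symmetric] vector_add_component
        by linarith
    qed
  qed (use Suc.prems(3,4) in auto)
  then obtain ts r where "walk x I q ts r" "exec \<alpha> y' ts"
    "\<forall>i. i \<notin> I \<longrightarrow> (y' + disp \<alpha> ts) $ i \<ge> int H" by blast
  then show ?case using walk_mono[OF us(1) Suc.prems(1)] ex
    by (intro exI[of _ "us @ ts"] exI[of _ r]) (auto simp: exec_append y'_def add.assoc intro: walk_appendI)
qed

end

section \<open>Strong connectivity and inversion in the graph projected to the bounded
  coordinates\<close>

locale projected_run = cyclic_run x \<alpha> n m
  for x \<alpha> :: "int \<Rightarrow> int ^ 'd" and n m +
  fixes I :: "'d set" and b :: nat
  assumes bounded: "i \<in> I \<Longrightarrow> x t $ i < int b"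
begin

abbreviation N :: nat where "N \<equiv> b ^ card I"

text \<open>Length of an inverse step: a zero-sum group of closed walks, each of length at most
  \<open>5 * N\<^sup>2\<close> and hence of displacement at most
  \<open>5 * m * N\<^sup>2\<close>.\<close>

definition F :: nat where "F = 5 * N\<^sup>2 * group_bound (5 * m * N\<^sup>2) CARD('d)"

lemma card_proj: "card (proj x I ` T) \<le> N"
  using card_proj_le bounded by blast

lemma N_pos: "N \<ge> 1"
  using card_proj[of "{0}"] by simp

lemma short_walk: "\<exists>us. walk x I p us q \<and> length us \<le> N"
proof -
  obtain s where s: "s \<ge> p" "x s = x q" using ex_later by blast
  obtain us where "walk x I p us s" "length us \<le> N"
    using walk_decompose[OF walk_upto[OF s(1)] card_proj] by blast
  moreover have "proj x I s = proj x I q" using s(2) by (simp add: proj_eq_iff)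
  ultimately show ?thesis using walk_cong_end by blast
qed

text \<open>Start with one period of the run, and for each \<open>r\<close> add a segment of the run
  from \<open>t\<close> through a visit of \<open>r\<close> back to \<open>t\<close>. Each of these
  has displacement zero, and shortening only moves displacement into the list of loops. A detour
  costs two shortened segments and one edge, hence \<open>2 * N + 1\<close>.\<close>

lemma tour:
  "\<exists>us ls. walk x I (t + 1) us t \<and> (\<forall>r\<in>set rs. \<exists>s\<in>set us. proj x I s = proj x I r) \<and>
    length us \<le> N + length rs * (2 * N + 1) \<and>
    (\<forall>l\<in>set ls. length l \<le> N \<and> walk x I (hd l) l (hd l)) \<and>
    \<alpha> t + disp \<alpha> us + sum_list (map (disp \<alpha>) ls) = 0"
proof (induction rs)
  case Nil
  have le: "t + 1 \<le> t + n" using period_pos by simp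
  obtain us ls where *: "walk x I (t + 1) us (t + n)" "length us \<le> N"
    "\<forall>l\<in>set ls. length l \<le> N \<and> walk x I (hd l) l (hd l)"
    "disp \<alpha> [t + 1..t + n - 1] = disp \<alpha> us + sum_list (map (disp \<alpha>) ls)"
    using walk_decompose[OF walk_upto[OF le] card_proj, of \<alpha>] by blast
  have "proj x I (t + n) = proj x I t" by (simp add: proj_eq_iff periodic)
  then have "walk x I (t + 1) us t" using *(1) walk_cong_end by blast
  moreover have "disp \<alpha> us + sum_list (map (disp \<alpha>) ls) = - \<alpha> t"
    unfolding *(4)[symmetric] disp_upto[OF le] by (simp add: periodic step)
  ultimately show ?case using * by (intro exI[of _ us] exI[of _ ls]) (auto simp: add.assoc)
next
  case (Cons r rs)
  then obtain us ls where IH: "walk x I (t + 1) us t"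
    "\<forall>r\<in>set rs. \<exists>s\<in>set us. proj x I s = proj x I r"
    "length us \<le> N + length rs * (2 * N + 1)"
    "\<forall>l\<in>set ls. length l \<le> N \<and> walk x I (hd l) l (hd l)"
    "\<alpha> t + disp \<alpha> us + sum_list (map (disp \<alpha>) ls) = 0" by blast
  obtain r' where r': "r' \<ge> t" "x r' = x r" using ex_later by blast
  obtain t' where t': "t' \<ge> r' + 1" "x t' = x t" using ex_later by blast
  obtain us1 ls1 where 1: "walk x I t us1 r'" "length us1 \<le> N"
    "\<forall>l\<in>set ls1. length l \<le> N \<and> walk x I (hd l) l (hd l)"
    "disp \<alpha> [t..r' - 1] = disp \<alpha> us1 + sum_list (map (disp \<alpha>) ls1)"
    using walk_decompose[OF walk_upto[OF r'(1)] card_proj, of \<alpha>] by blast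
  obtain us2 ls2 where 2: "walk x I (r' + 1) us2 t'" "length us2 \<le> N"
    "\<forall>l\<in>set ls2. length l \<le> N \<and> walk x I (hd l) l (hd l)"
    "disp \<alpha> [r' + 1..t' - 1] = disp \<alpha> us2 + sum_list (map (disp \<alpha>) ls2)"
    using walk_decompose[OF walk_upto[OF t'(1)] card_proj, of \<alpha>] by blast
  have "proj x I t' = proj x I t" by (simp add: proj_eq_iff t'(2))
  then have w2: "walk x I (r' + 1) us2 t" using 2(1) walk_cong_end by blast
  have d: "(disp \<alpha> us1 + sum_list (map (disp \<alpha>) ls1)) + \<alpha> r' + (disp \<alpha> us2 + sum_list (map (disp \<alpha>) ls2)) = 0"
    unfolding 1(4)[symmetric] 2(4)[symmetric] disp_upto[OF r'(1)] disp_upto[OF t'(1)]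
    by (simp add: t'(2) step)
  have pr: "proj x I r' = proj x I r" by (simp add: proj_eq_iff r'(2))
  show ?case
  \<comment> \<open>The edge \<open>r'\<close> is kept out of both shortened segments, so that
    excision cannot lose the vertex of \<open>r\<close>.\<close>
  proof (intro exI[of _ "us @ us1 @ r' # us2"] exI[of _ "ls @ ls1 @ ls2"] conjI)
    have "walk x I r' (r' # us2) t" using w2 by simp
    then show "walk x I (t + 1) (us @ us1 @ r' # us2) t" using IH(1) 1(1) walk_appendI by blast
    show "\<alpha> t + disp \<alpha> (us @ us1 @ r' # us2) + sum_list (map (disp \<alpha>) (ls @ ls1 @ ls2)) = 0"
    proof -
      have "\<alpha> t + disp \<alpha> (us @ us1 @ r' # us2) + sum_list (map (disp \<alpha>) (ls @ ls1 @ ls2)) =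
        (\<alpha> t + disp \<alpha> us + sum_list (map (disp \<alpha>) ls)) +
        ((disp \<alpha> us1 + sum_list (map (disp \<alpha>) ls1)) + \<alpha> r' + (disp \<alpha> us2 + sum_list (map (disp \<alpha>) ls2)))"
        by (simp add: ac_simps)
      then show ?thesis using d IH(5) by simp
    qed
  qed (use IH 1 2 pr in auto)
qed

text \<open>Since the walk visits every vertex, each loop can be spliced in at a visit of its base,
  and the longer walk still visits every vertex.\<close>

lemma insert_loops:
  assumes "walk x I p us q" "\<forall>r. \<exists>s\<in>set us. proj x I s = proj x I r"
    "\<forall>l\<in>set ls. walk x I (hd l) l (hd l)"
  shows "\<exists>vs. walk x I p vs q \<and> disp \<alpha> vs = disp \<alpha> us + sum_list (map (disp \<alpha>) ls) \<and>
    length vs = length us + sum_list (map length ls)"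
  using assms
proof (induction ls arbitrary: us)
  case Nil
  then show ?case by auto
next
  case (Cons l ls)
  obtain s where s: "s \<in> set us" "proj x I s = proj x I (hd l)" using Cons.prems(2) by blast
  obtain us1 us2 where us: "us = us1 @ s # us2" using s(1) by (meson split_list)
  have w: "walk x I p us1 s" "walk x I s (s # us2) q"
    using Cons.prems(1) unfolding us walk_append_Cons by auto
  have "walk x I s l s" using Cons.prems(3) s(2) walk_cong_start walk_cong_end by (metis list.set_intros(1))
  then have "walk x I p (us1 @ l @ s # us2) q" using w walk_appendI by blast
  moreover have "\<forall>r. \<exists>s\<in>set (us1 @ l @ s # us2). proj x I s = proj x I r"
    using Cons.prems(2) unfolding us by auto
  ultimately obtain vs where "walk x I p vs q"
    "disp \<alpha> vs = disp \<alpha> (us1 @ l @ s # us2) + sum_list (map (disp \<alpha>) ls)"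
    "length vs = length (us1 @ l @ s # us2) + sum_list (map length ls)"
    using Cons.IH[of "us1 @ l @ s # us2"] Cons.prems(3) by auto
  then show ?case unfolding us by (intro exI[of _ vs]) (auto simp: ac_simps)
qed

text \<open>A closed walk that starts with \<open>t\<close> and visits all vertices, together with the loops removed
  when shortening it, has displacement zero. The zero-sum group that contains this walk is short,
  and its loops can be inserted into the walk.\<close>

lemma inverse_step:
  "\<exists>us. walk x I (t + 1) us t \<and> disp \<alpha> us = - \<alpha> t \<and> length us \<le> F"
proof -
  have fin: "finite (range (proj x I))" using card_proj_le(1) bounded by blast
  \<comment> \<open>One representative time per vertex, so the tour has at most \<open>N\<close>
    targets.\<close>
  obtain R where R: "inj_on (proj x I) R" "range (proj x I) = proj x I ` R"
    by (metis subset_image_inj subset_refl)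
  have finR: "finite R" using fin R finite_image_iff by metis
  obtain rs where rs: "set rs = R" "distinct rs" using finite_distinct_list[OF finR] by blast
  have len_rs: "length rs \<le> N"
    using card_proj[of R] card_image[OF R(1)] distinct_card[OF rs(2)] rs(1) by simp
  obtain us ls where us: "walk x I (t + 1) us t" "\<forall>r\<in>set rs. \<exists>s\<in>set us. proj x I s = proj x I r"
    "length us \<le> N + length rs * (2 * N + 1)"
    "\<forall>l\<in>set ls. length l \<le> N \<and> walk x I (hd l) l (hd l)"
    "\<alpha> t + disp \<alpha> us + sum_list (map (disp \<alpha>) ls) = 0"
    using tour by blast
  have all: "\<forall>r. \<exists>s\<in>set us. proj x I s = proj x I r"
    using us(2) R(2) rs(1) by (metis imageE rangeI)
  have NN: "N \<le> N\<^sup>2" using N_pos by (simp add: power2_eq_square)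
  have "length us + 1 \<le> N + N * (2 * N + 1) + 1"
    using us(3) len_rs by (meson add_le_mono add_le_mono1 le_trans mult_le_mono1 order_refl)
  also have "\<dots> = 2 * N\<^sup>2 + 2 * N + 1" by (simp add: power2_eq_square algebra_simps)
  also have "\<dots> \<le> 5 * N\<^sup>2" using NN N_pos by linarith
  finally have len_us: "length (t # us) \<le> 5 * N\<^sup>2" by simp
  let ?items = "(t # us) # ls"
  have items: "length l \<le> 5 * N\<^sup>2 \<and> walk x I (hd l) l (hd l)" if "l \<in> set ?items" for l
  proof (cases "l = t # us")
    case True
    then show ?thesis using len_us us(1) by simp
  next
    case False
    then have "l \<in> set ls" using that by auto
    then have "length l \<le> N" "walk x I (hd l) l (hd l)" using us(4) by auto
    then show ?thesis using NN by linarith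
  qed
  let ?G = "group_bound (5 * m * N\<^sup>2) (card (UNIV :: 'd set))"
  have "\<exists>gs. mset (concat gs) = mset ?items \<and>
    (\<forall>g\<in>set gs. length g \<le> ?G \<and> (\<forall>i\<in>UNIV. sum_list (map (\<lambda>v. disp \<alpha> v $ i) g) = 0))"
  proof (rule zero_sum_partition)
    show "\<forall>v\<in>set ?items. \<forall>i\<in>UNIV. \<bar>disp \<alpha> v $ i\<bar> \<le> int (5 * m * N\<^sup>2)"
    proof (intro ballI)
      fix v i assume "v \<in> set ?items"
      then have "length v \<le> 5 * N\<^sup>2" using items by blast
      then have "m * length v \<le> m * (5 * N\<^sup>2)" by (rule mult_le_mono2)
      then have "int (m * length v) \<le> int (5 * m * N\<^sup>2)" by (simp only: of_nat_le_iff ac_simps)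
      then show "\<bar>disp \<alpha> v $ i\<bar> \<le> int (5 * m * N\<^sup>2)" using disp_le[of v i] by linarith
    qed
    have "sum_list (map (\<lambda>v. disp \<alpha> v $ i) ?items) = (\<alpha> t + disp \<alpha> us + sum_list (map (disp \<alpha>) ls)) $ i" for i
    proof -
      have "sum_list (map (\<lambda>v. disp \<alpha> v $ i) ls) = sum_list (map (disp \<alpha>) ls) $ i"
        by (induction ls) auto
      then show ?thesis by simp
    qed
    then show "\<forall>i\<in>UNIV. sum_list (map (\<lambda>v. disp \<alpha> v $ i) ?items) = 0" using us(5) by simp
  qed simp
  then obtain gs where gs: "mset (concat gs) = mset ?items"
    "\<forall>g\<in>set gs. length g \<le> ?G \<and> (\<forall>i\<in>UNIV. sum_list (map (\<lambda>v. disp \<alpha> v $ i) g) = 0)" by blast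
  have sgs: "set (concat gs) = set ?items" using gs(1) by (metis set_mset_mset)
  then obtain g where g: "g \<in> set gs" "t # us \<in> set g" by auto
  have gsub: "set g \<subseteq> set ?items" using g(1) sgs by auto
  define g' where "g' = remove1 (t # us) g"
  have g': "mset g = mset ((t # us) # g')" unfolding g'_def using g(2) by simp
  have "set g' \<subseteq> set g" unfolding g'_def by (rule set_remove1_subset)
  then have "\<forall>l\<in>set g'. walk x I (hd l) l (hd l)" using gsub items by blast
  then obtain vs where vs: "walk x I (t + 1) vs t" "disp \<alpha> vs = disp \<alpha> us + sum_list (map (disp \<alpha>) g')"
    "length vs = length us + sum_list (map length g')" using insert_loops[OF us(1) all] by blast
  have "sum_list (map (disp \<alpha>) g) = disp \<alpha> (t # us) + sum_list (map (disp \<alpha>) g')"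
    using sum_list_mset_cong[OF g', of "disp \<alpha>"] by simp
  then have "\<alpha> t + disp \<alpha> vs = sum_list (map (disp \<alpha>) g)" unfolding vs(2) by (simp add: add.assoc)
  moreover have "sum_list (map (disp \<alpha>) g) $ i = sum_list (map (\<lambda>v. disp \<alpha> v $ i) g)" for i
    by (induction g) auto
  ultimately have "\<alpha> t + disp \<alpha> vs = 0" using gs(2) g(1) by (simp add: vec_eq_iff)
  then have d: "disp \<alpha> vs = - \<alpha> t" by (metis add.commute eq_neg_iff_add_eq_0)
  have "length vs \<le> length (t # us) + sum_list (map length g')" using vs(3) by simp
  also have "\<dots> = sum_list (map length g)" using sum_list_mset_cong[OF g', of length] by simp
  also have "\<dots> = length (concat g)" by (simp add: length_concat)
  also have "\<dots> \<le> length g * (5 * N\<^sup>2)" using gsub items by (intro length_concat_le) blast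
  also have "\<dots> \<le> ?G * (5 * N\<^sup>2)" using gs(2) g(1) by (intro mult_le_mono1) blast
  finally have "length vs \<le> F" unfolding F_def by (simp add: mult.commute)
  then show ?thesis using vs(1) d by blast
qed

lemma inverse_walk:
  assumes "walk x I p ts q"
  shows "\<exists>us. walk x I q us p \<and> disp \<alpha> us = - disp \<alpha> ts \<and> length us \<le> length ts * F"
  using assms
proof (induction ts arbitrary: p)
  case Nil
  then show ?case by (intro exI[of _ "[]"]) simp
next
  case (Cons t ts)
  then obtain us where us: "walk x I q us (t + 1)" "disp \<alpha> us = - disp \<alpha> ts" "length us \<le> length ts * F"
    by auto
  obtain vs where vs: "walk x I (t + 1) vs t" "disp \<alpha> vs = - \<alpha> t" "length vs \<le> F"
    using inverse_step by blast
  have "proj x I t = proj x I p" using Cons.prems by simp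
  then have "walk x I q (us @ vs) p" using us(1) vs(1) walk_appendI walk_cong_end by metis
  then show ?case using us vs by (intro exI[of _ "us @ vs"]) auto
qed

text \<open>Length of the loops used in \<open>steer\<close>: a short walk, an inverse step, and the
  inverse of a short walk.\<close>

definition L :: nat where "L = N + F + N * F"

text \<open>The most that a coordinate can lose inside one group of such loops. Their displacement
  is at most \<open>m * (2 * N + 1)\<close>: two short walks and one action.\<close>

definition steer_bound :: nat where
  "steer_bound = m * (group_bound (m * (2 * N + 1)) CARD('d) * L)"

text \<open>The short closed walks that add up to the displacement are interleaved by grouping them with
  fillers \<open>fs\<close> into short zero-sum groups. Since the fillers have constant signs, the configurations
  between two groups stay, coordinatewise, between the two ends.\<close>

lemma steer:
  assumes u: "walk x I p ts p"
    and yI: "\<And>i. i \<in> I \<Longrightarrow> y $ i = x p $ i"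
    and y1: "\<And>i. i \<notin> I \<Longrightarrow> y $ i \<ge> int steer_bound"
    and y2: "\<And>i. i \<notin> I \<Longrightarrow> (y - disp \<alpha> ts) $ i \<ge> int steer_bound"
  shows "\<exists>us. walk x I p us p \<and> disp \<alpha> us = - disp \<alpha> ts \<and> exec \<alpha> y us"
proof -
  define K where "K = m * (2 * N + 1)"
  \<comment> \<open>The choice depends only on the vertex of \<open>s\<close>, so all times at the
    same vertex share one walk; the telescoping below relies on this.\<close>
  define \<pi> where "\<pi> s = (SOME us. walk x I p us s \<and> length us \<le> N)" for s
  have \<pi>: "walk x I p (\<pi> s) s" "length (\<pi> s) \<le> N" for s
    unfolding \<pi>_def using someI_ex[OF short_walk] by blast+
  have \<pi>_cong: "\<pi> s = \<pi> s'" if "proj x I s = proj x I s'" for s s'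
    unfolding \<pi>_def using walk_cong_end[OF that] by simp
  \<comment> \<open>The loop follows \<open>\<pi> (t + 1)\<close> to the end of the edge
    \<open>t\<close>, undoes that edge, and returns by an inverse of \<open>\<pi> t\<close>.\<close>
  have "\<exists>l. walk x I p l p \<and> length l \<le> L \<and> disp \<alpha> l = disp \<alpha> (\<pi> (t + 1)) - \<alpha> t - disp \<alpha> (\<pi> t)" for t
  proof -
    obtain us where us: "walk x I (t + 1) us t" "disp \<alpha> us = - \<alpha> t" "length us \<le> F"
      using inverse_step by blast
    obtain vs where vs: "walk x I t vs p" "disp \<alpha> vs = - disp \<alpha> (\<pi> t)" "length vs \<le> length (\<pi> t) * F"
      using inverse_walk[OF \<pi>(1)] by blast
    have "length vs \<le> N * F" using vs(3) \<pi>(2)[of t] by (meson le_trans mult_le_mono1)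
    then show ?thesis using us vs \<pi>[of "t + 1"] unfolding L_def
      by (intro exI[of _ "\<pi> (t + 1) @ us @ vs"]) (auto intro!: walk_appendI)
  qed
  then obtain \<Lambda> where \<Lambda>: "\<And>t. walk x I p (\<Lambda> t) p" "\<And>t. length (\<Lambda> t) \<le> L"
    "\<And>t. disp \<alpha> (\<Lambda> t) = disp \<alpha> (\<pi> (t + 1)) - \<alpha> t - disp \<alpha> (\<pi> t)" by metis
  \<comment> \<open>Along a closed walk the two boundary terms cancel, so the loops together undo
    its displacement.\<close>
  have tele: "sum_list (map (\<lambda>t. disp \<alpha> (\<Lambda> t)) vs) = disp \<alpha> (\<pi> r) - disp \<alpha> vs - disp \<alpha> (\<pi> q)"
    if "walk x I q vs r" for vs q r
    using that
  proof (induction vs arbitrary: q)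
    case Nil
    then show ?case using \<pi>_cong[of q r] by simp
  next
    case (Cons t vs)
    then have *: "\<pi> q = \<pi> t" using \<pi>_cong[of q t] by simp
    have IH: "sum_list (map (\<lambda>t. disp \<alpha> (\<Lambda> t)) vs) = disp \<alpha> (\<pi> r) - disp \<alpha> vs - disp \<alpha> (\<pi> (t + 1))"
      using Cons by simp
    show ?case unfolding list.map sum_list.Cons IH disp_simps using * \<Lambda>(3)[of t] by simp
  qed
  have \<Lambda>_le: "\<bar>disp \<alpha> (\<Lambda> t) $ i\<bar> \<le> int K" for t i
  proof -
    have "\<bar>disp \<alpha> (\<pi> s) $ i\<bar> \<le> int (m * N)" for s
      using disp_le[of "\<pi> s" i] mult_le_mono2[OF \<pi>(2)[of s], of m] by linarith
    from this[of t] this[of "t + 1"] have "\<bar>disp \<alpha> (\<Lambda> t) $ i\<bar> \<le> int (m * N) + int m + int (m * N)"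
      using action_le[of t i] unfolding \<Lambda>(3) vector_minus_component by linarith
    also have "\<dots> = int K" unfolding K_def by (simp add: algebra_simps)
    finally show ?thesis .
  qed
  have "\<forall>i. \<bar>disp \<alpha> ts $ i\<bar> \<le> int (length ts) * int K"
  proof
    fix i
    have "m * length ts \<le> length ts * K" unfolding K_def by (simp add: algebra_simps)
    then show "\<bar>disp \<alpha> ts $ i\<bar> \<le> int (length ts) * int K"
      using disp_le[of ts i] by (simp only: of_nat_mult[symmetric])
  qed
  then obtain fs where fs: "sum_list fs = disp \<alpha> ts" "\<forall>f\<in>set fs. \<forall>i. \<bar>f $ i\<bar> \<le> int K \<and>
    (disp \<alpha> ts $ i \<ge> 0 \<longrightarrow> f $ i \<ge> 0) \<and> (disp \<alpha> ts $ i \<le> 0 \<longrightarrow> f $ i \<le> 0)"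
    using clamp_decomposition[of "disp \<alpha> ts" "length ts" K] by auto
  \<comment> \<open>An item pairs a word with a filler: loops carry the filler zero, and fillers
    carry the empty word.\<close>
  define items where "items = map (\<lambda>t. (\<Lambda> t, 0)) ts @ map (\<lambda>f. ([], f)) fs"
  define w where "w v i = disp \<alpha> (fst v) $ i + snd v $ i" for v :: "int list \<times> (int ^ 'd)" and i
  let ?B = "group_bound K (card (UNIV :: 'd set))"
  have fst_items: "walk x I p (fst v) p" "length (fst v) \<le> L" if "v \<in> set items" for v
    using that \<Lambda> unfolding items_def by auto
  have snd_items: "disp \<alpha> ts $ i \<ge> 0 \<longrightarrow> snd v $ i \<ge> 0" "disp \<alpha> ts $ i \<le> 0 \<longrightarrow> snd v $ i \<le> 0"
    if "v \<in> set items" for v i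
    using that fs(2) unfolding items_def by auto
  have sum_nth: "sum_list (map (\<lambda>v. f v $ i) l) = sum_list (map f l) $ i"
    for f :: "'b \<Rightarrow> int ^ 'd" and i l
    by (induction l) auto
  have sum_fst: "sum_list (map (\<lambda>v. disp \<alpha> (fst v)) items) = - disp \<alpha> ts"
  proof -
    have "sum_list (map (\<lambda>v. disp \<alpha> (fst v)) items) = sum_list (map (\<lambda>t. disp \<alpha> (\<Lambda> t)) ts)"
      unfolding items_def by (simp add: comp_def sum_list_0)
    then show ?thesis using tele[OF u] by simp
  qed
  have sum_snd: "sum_list (map snd items) = disp \<alpha> ts"
    unfolding items_def using fs(1) by (simp add: comp_def sum_list_0)
  have "\<exists>gs. mset (concat gs) = mset items \<and>
    (\<forall>g\<in>set gs. length g \<le> ?B \<and> (\<forall>i\<in>UNIV. sum_list (map (\<lambda>v. w v i) g) = 0))"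
  proof (rule zero_sum_partition)
    show "\<forall>v\<in>set items. \<forall>i\<in>UNIV. \<bar>w v i\<bar> \<le> int K"
      using \<Lambda>_le fs(2) unfolding items_def w_def by auto
    have "sum_list (map (\<lambda>v. w v i) items) = 0" for i
      using sum_fst sum_snd unfolding w_def sum_list_addf sum_nth by simp
    then show "\<forall>i\<in>UNIV. sum_list (map (\<lambda>v. w v i) items) = 0" by blast
  qed simp
  then obtain gs where gs: "mset (concat gs) = mset items"
    "\<And>g. g \<in> set gs \<Longrightarrow> length g \<le> ?B" "\<And>g i. g \<in> set gs \<Longrightarrow> sum_list (map (\<lambda>v. w v i) g) = 0" by blast
  have sgs: "set (concat gs) = set items" using gs(1) by (metis set_mset_mset)
  define word where "word g = concat (map fst g)" for g :: "(int list \<times> (int ^ 'd)) list"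
  have disp_words: "disp \<alpha> (concat (map word hs)) = sum_list (map (\<lambda>v. disp \<alpha> (fst v)) (concat hs))"
    for hs
    unfolding word_def by (induction hs) (simp_all add: disp_concat comp_def)
  have word_walk: "walk x I p (word g) p" if "g \<in> set gs" for g
    unfolding word_def using that sgs fst_items(1) by (intro walk_concat) auto
  have word_length: "length (word g) \<le> ?B * L" if g: "g \<in> set gs" for g
  proof -
    have "length (word g) \<le> length (map fst g) * L"
      unfolding word_def using g sgs fst_items(2) by (intro length_concat_le) auto
    also have "\<dots> \<le> ?B * L" using gs(2)[OF g] by (intro mult_le_mono1) simp
    finally show ?thesis .
  qed
  \<comment> \<open>Completed groups cancel, so their words displace \<open>y\<close> by minus the
    sum \<open>S1\<close> of their fillers. As all fillers have the sign of
    \<open>disp \<alpha> ts $ i\<close>, the value lies between the two ends, both at least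
    \<open>steer_bound\<close>.\<close>
  have boundary: "(y + disp \<alpha> (concat (map word g1))) $ i \<ge> int steer_bound"
    if g: "gs = g1 @ g2" and i: "i \<notin> I" for g1 g2 i
  proof -
    define S1 where "S1 = sum_list (map (\<lambda>v. snd v $ i) (concat g1))"
    define S2 where "S2 = sum_list (map (\<lambda>v. snd v $ i) (concat g2))"
    have "sum_list (map (\<lambda>v. w v i) (concat g1)) = 0"
    proof -
      have "\<forall>g\<in>set g1. sum_list (map (\<lambda>v. w v i) g) = 0" using gs(3) g by simp
      then show ?thesis by (induction g1) auto
    qed
    then have d: "disp \<alpha> (concat (map word g1)) $ i = - S1"
      unfolding disp_words S1_def w_def sum_list_addf sum_nth by linarith
    have "S1 + S2 = sum_list (map (\<lambda>v. snd v $ i) (concat gs))" unfolding S1_def S2_def g by simp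
    also have "\<dots> = sum_list (map (\<lambda>v. snd v $ i) items)" by (rule sum_list_mset_cong[OF gs(1)])
    also have "\<dots> = disp \<alpha> ts $ i" using sum_snd by (simp add: sum_nth)
    finally have S: "S1 + S2 = disp \<alpha> ts $ i" .
    have sub: "set (concat g1) \<subseteq> set items" "set (concat g2) \<subseteq> set items" using sgs g by auto
    show ?thesis
    proof (cases "disp \<alpha> ts $ i \<ge> 0")
      case True
      then have "S2 \<ge> 0" unfolding S2_def using sub(2) snd_items(1) by (intro sum_list_nonneg) auto
      then show ?thesis using y2[OF i] S d by simp
    next
      case False
      then have "- S1 \<ge> 0" unfolding S1_def uminus_sum_list_map
        using sub(1) snd_items(2) by (intro sum_list_nonneg) auto
      then show ?thesis using y1[OF i] d by simp
    qed
  qed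
  have words_walk: "walk x I p (concat (map word g1)) p" if "set g1 \<subseteq> set gs" for g1
    using that word_walk by (intro walk_concat) auto
  have on_I: "(y + disp \<alpha> (concat (map word g1))) $ i = x p $ i"
    if g: "set g1 \<subseteq> set gs" and i: "i \<in> I" for g1 i
    using walk_disp[OF words_walk[OF g] i] yI[OF i] by simp
  have "exec \<alpha> y (concat (map word gs))"
  proof (rule exec_concat)
    fix us g vs assume "map word gs = us @ g # vs"
    then obtain g1 h g2 where g: "gs = g1 @ h # g2" "us = map word g1" "g = word h"
      by (auto simp: map_eq_append_conv)
    have "m * length g \<le> steer_bound"
      unfolding steer_bound_def K_def[symmetric] using word_length[of h] g(1,3) by (intro mult_le_mono2) simp
    then have "int (m * length g) \<le> (y + disp \<alpha> (concat us)) $ i" if "i \<notin> I" for i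
      using boundary[OF g(1) that] unfolding g(2) by linarith
    moreover have "(y + disp \<alpha> (concat us)) $ i = x p $ i" if "i \<in> I" for i
      using on_I[of g1 i] g(1,2) that by auto
    moreover have "walk x I p g p" using word_walk g(1,3) by simp
    ultimately show "exec \<alpha> (y + disp \<alpha> (concat us)) g" using exec_walk by blast
  next
    have "0 \<le> (y + disp \<alpha> (concat (map word gs))) $ i" for i
    proof (cases "i \<in> I")
      case True
      then show ?thesis using on_I[of gs i] nonneg by simp
    next
      case False
      then show ?thesis using boundary[of gs "[]" i] by simp
    qed
    then show "exec \<alpha> (y + disp \<alpha> (concat (map word gs))) []" by simp
  qed
  moreover have "disp \<alpha> (concat (map word gs)) = - disp \<alpha> ts"
    unfolding disp_words sum_list_mset_cong[OF gs(1)] by (rule sum_fst)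
  ultimately show ?thesis using words_walk by blast
qed

end

section \<open>Time reversal and the truncated cycle\<close>

text \<open>In the reversed run, step \<open>t\<close> leads from \<open>x (- t)\<close> to
  \<open>x (- t - 1)\<close>; it undoes the original step \<open>- t - 1\<close>, which explains the
  shift by one.\<close>

definition reverse_times :: "int list \<Rightarrow> int list" where
  "reverse_times ts = rev (map (\<lambda>t. - t - 1) ts)"

lemma reverse_times_simps [simp]:
  "reverse_times [] = []" "reverse_times (t # ts) = reverse_times ts @ [- t - 1]"
  by (simp_all add: reverse_times_def)

lemma proj_reverse: "proj (\<lambda>t. x (- t)) S p = proj x S (- p)"
  by (simp add: proj_def)

lemma walk_reverse:
  "walk (\<lambda>t. x (- t)) S p ts q \<Longrightarrow> walk x S (- q) (reverse_times ts) (- p)"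
proof (induction ts arbitrary: p)
  case Nil
  then show ?case by (simp add: proj_reverse)
next
  case (Cons t ts)
  then have "walk x S (- q) (reverse_times ts) (- t - 1)" by force
  moreover have "walk x S (- t - 1) [- t - 1] (- p)" using Cons.prems by (simp add: proj_reverse)
  ultimately show ?case by (auto intro: walk_appendI)
qed

lemma disp_reverse: "disp \<alpha> (reverse_times ts) = - disp (\<lambda>t. - \<alpha> (- t - 1)) ts"
  by (induction ts) auto

lemma exec_reverse:
  "exec (\<lambda>t. - \<alpha> (- t - 1)) y ts \<Longrightarrow>
    exec \<alpha> (y + disp (\<lambda>t. - \<alpha> (- t - 1)) ts) (reverse_times ts)"
proof (induction ts arbitrary: y)
  case (Cons t ts)
  let ?y = "y + - \<alpha> (- t - 1)"
  have e: "exec (\<lambda>t. - \<alpha> (- t - 1)) ?y ts" using Cons.prems by simp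
  have "exec \<alpha> ?y [- t - 1]" using exec_nonneg[OF e] exec_nonneg[OF Cons.prems] by simp
  then show ?case using Cons.IH[OF e] by (simp add: exec_append disp_reverse algebra_simps)
qed simp

context projected_run
begin

lemma reversed: "projected_run (\<lambda>t. x (- t)) (\<lambda>t. - \<alpha> (- t - 1)) n m I b"
proof
  fix t i
  show "x (- (t + 1)) = x (- t) + - \<alpha> (- t - 1)" using step[of "- t - 1"] by simp
  show "x (- (t + n)) = x (- t)" using periodic[of "- t - n"] by simp
  show "\<bar>(- \<alpha> (- t - 1)) $ i\<bar> \<le> int m" using action_le[of "- t - 1" i] by simp
qed (use period_pos nonneg bounded in auto)

text \<open>The target height adds to \<open>steer_bound\<close> the cost \<open>m * N\<close> of a
  final short walk; the summand \<open>b\<close> puts the coordinates in \<open>I\<close> below the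
  target, as \<open>pump_up\<close> requires.\<close>

definition pump_bound :: nat where "pump_bound =
  escape_bound m (card I) (steer_bound + m * N + b) (CARD('d) - card I)"

text \<open>\<open>pump_up\<close> ends at an uncontrolled vertex; a short walk then leads to
  \<open>q\<close> and costs at most \<open>m * N\<close>.\<close>

lemma pump_to:
  assumes "I \<subseteq> S" "\<And>i. i \<notin> I \<Longrightarrow> \<exists>t. x t $ i \<ge> int M" "pump_bound \<le> M"
    and "\<And>i. i \<in> S \<Longrightarrow> y $ i = x p $ i"
    and "\<And>i. i \<notin> S \<Longrightarrow> y $ i \<ge> int pump_bound"
  shows "\<exists>ts. walk x I p ts q \<and> exec \<alpha> y ts \<and>
    (\<forall>i. i \<notin> I \<longrightarrow> (y + disp \<alpha> ts) $ i \<ge> int steer_bound)"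
proof -
  let ?H = "steer_bound + m * N + b"
  define k where "k = card S - card I"
  have k: "card S = card I + k" unfolding k_def using card_mono[OF _ assms(1)] by simp
  have "card S \<le> CARD('d)" by (simp add: card_mono)
  then have le: "escape_bound m (card I) ?H k \<le> pump_bound"
    unfolding pump_bound_def k_def by (intro escape_bound_mono) simp
  have "\<exists>ts r. walk x I p ts r \<and> exec \<alpha> y ts \<and> (\<forall>i. i \<notin> I \<longrightarrow> (y + disp \<alpha> ts) $ i \<ge> int ?H)"
  proof (rule pump_up[OF assms(1) k _ assms(2)])
    show "x t $ i < int ?H" if "i \<in> I" for t i
      using bounded[OF that, of t] by (simp add: add_increasing order_less_le_trans)
    show "escape_bound m (card I) ?H k \<le> M" using le assms(3) by simp
    show "y $ i \<ge> int (escape_bound m (card I) ?H k)" if "i \<notin> S" for i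
      using assms(5)[OF that] le by linarith
  qed (use assms(4) in auto)
  then obtain ts r where ts: "walk x I p ts r" "exec \<alpha> y ts"
    "\<And>i. i \<notin> I \<Longrightarrow> (y + disp \<alpha> ts) $ i \<ge> int ?H" by blast
  obtain us where us: "walk x I r us q" "length us \<le> N" using short_walk by blast
  have mus: "m * length us \<le> m * N" using us(2) by simp
  have w: "walk x I p (ts @ us) q" using ts(1) us(1) walk_appendI by blast
  show ?thesis
  proof (intro exI[of _ "ts @ us"] conjI w)
    have yI: "y $ i = x p $ i" if "i \<in> I" for i using assms(1,4) that by blast
    have "exec \<alpha> (y + disp \<alpha> ts) us"
    proof (rule exec_walk[OF us(1)])
      show "\<forall>i\<in>I. (y + disp \<alpha> ts) $ i = x r $ i" using walk_disp[OF ts(1)] yI by simp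
      show "\<forall>i. i \<notin> I \<longrightarrow> (y + disp \<alpha> ts) $ i \<ge> int (m * length us)"
      proof (intro allI impI)
        fix i assume "i \<notin> I"
        then show "(y + disp \<alpha> ts) $ i \<ge> int (m * length us)" using ts(3)[of i] mus by linarith
      qed
    qed
    then show "exec \<alpha> y (ts @ us)" using ts(2) by (simp add: exec_append)
    show "\<forall>i. i \<notin> I \<longrightarrow> (y + disp \<alpha> (ts @ us)) $ i \<ge> int steer_bound"
    proof (intro allI impI)
      fix i assume "i \<notin> I"
      then have "(y + disp \<alpha> ts) $ i \<ge> int ?H" by (rule ts(3))
      moreover have "\<bar>disp \<alpha> us $ i\<bar> \<le> int (m * length us)" by (rule disp_le)
      ultimately show "(y + disp \<alpha> (ts @ us)) $ i \<ge> int steer_bound"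
        using mus unfolding disp_simps vector_add_component by linarith
    qed
  qed
qed

text \<open>The cycle is \<open>0 # us @ ws @ vs\<close>: \<open>us\<close> raises the coordinates
  after the first action, \<open>vs\<close> is the time reversal of a pumping word from
  \<open>y\<close>, and \<open>ws\<close> links the two high configurations. The slack
  \<open>m\<close> pays for the first action.\<close>

lemma cycle_from_truncation:
  assumes far: "\<And>i. i \<notin> I \<Longrightarrow> \<exists>t. x t $ i \<ge> int (pump_bound + m)"
    and y: "\<And>i. y $ i = min (x 0 $ i) (int (pump_bound + m))"
  shows "\<exists>ts. exec \<alpha> y (0 # ts) \<and> disp \<alpha> (0 # ts) = 0"
proof -
  define S where "S = {i. x 0 $ i < int (pump_bound + m)}"
  have "b \<le> pump_bound"
    unfolding pump_bound_def
    by (rule le_trans[OF _ escape_bound_mono[of 0]]) auto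
  then have "x 0 $ i < int (pump_bound + m)" if "i \<in> I" for i
    using bounded[OF that, of 0] by linarith
  then have IS: "I \<subseteq> S" unfolding S_def by blast
  have yS: "y $ i = x 0 $ i" if "i \<in> S" for i using that y unfolding S_def by simp
  have ynS: "y $ i = int (pump_bound + m)" if "i \<notin> S" for i using that y unfolding S_def by simp
  have y0: "0 \<le> y $ i" for i using y nonneg by simp
  have "\<exists>us. walk x I 1 us 0 \<and> exec \<alpha> (y + \<alpha> 0) us \<and>
    (\<forall>i. i \<notin> I \<longrightarrow> (y + \<alpha> 0 + disp \<alpha> us) $ i \<ge> int steer_bound)"
  proof (rule pump_to[OF IS far])
    show "(y + \<alpha> 0) $ i = x 1 $ i" if "i \<in> S" for i using yS[OF that] step[of 0] by simp
    show "(y + \<alpha> 0) $ i \<ge> int pump_bound" if "i \<notin> S" for i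
      using ynS[OF that] action_le[of 0 i] by simp
  qed simp_all
  then obtain us where us: "walk x I 1 us 0" "exec \<alpha> (y + \<alpha> 0) us"
    "\<And>i. i \<notin> I \<Longrightarrow> (y + \<alpha> 0 + disp \<alpha> us) $ i \<ge> int steer_bound" by blast
  let ?xr = "\<lambda>t. x (- t)" and ?\<alpha>r = "\<lambda>t. - \<alpha> (- t - 1)"
  \<comment> \<open>The bounds depend only on \<open>m\<close>, \<open>I\<close> and
    \<open>b\<close>, so they are the same for the reversed run.\<close>
  interpret rev: projected_run ?xr ?\<alpha>r n m I b by (rule reversed)
  have "\<exists>vs. walk ?xr I 0 vs 0 \<and> exec ?\<alpha>r y vs \<and>
    (\<forall>i. i \<notin> I \<longrightarrow> (y + disp ?\<alpha>r vs) $ i \<ge> int steer_bound)"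
  proof (rule rev.pump_to[OF IS])
    show "\<exists>t. x (- t) $ i \<ge> int (pump_bound + m)" if "i \<notin> I" for i
      using far[OF that] by (metis minus_minus)
  qed (use yS ynS in simp_all)
  then obtain vs' where vs': "walk ?xr I 0 vs' 0" "exec ?\<alpha>r y vs'"
    "\<And>i. i \<notin> I \<Longrightarrow> (y + disp ?\<alpha>r vs') $ i \<ge> int steer_bound" by blast
  define vs where "vs = reverse_times vs'"
  have vs: "walk x I 0 vs 0" using walk_reverse[OF vs'(1)] by (simp add: vs_def)
  have dvs: "disp ?\<alpha>r vs' = - disp \<alpha> vs" by (simp add: vs_def disp_reverse)
  have evs: "exec \<alpha> (y - disp \<alpha> vs) vs"
    using exec_reverse[OF vs'(2)] unfolding dvs by (simp add: vs_def)
  let ?y1 = "y + \<alpha> 0 + disp \<alpha> us"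
  have u0: "walk x I 0 (0 # us) 0" using us(1) by simp
  \<comment> \<open>Undoing the closed walk \<open>vs @ 0 # us\<close> from \<open>?y1\<close> ends
    at \<open>y - disp \<alpha> vs\<close>, the configuration from which \<open>vs\<close> returns
    to \<open>y\<close>.\<close>
  have "\<exists>ws. walk x I 0 ws 0 \<and> disp \<alpha> ws = - disp \<alpha> (vs @ 0 # us) \<and> exec \<alpha> ?y1 ws"
  proof (rule steer)
    show "walk x I 0 (vs @ 0 # us) 0" using vs u0 walk_appendI by blast
    show "?y1 $ i = x 0 $ i" if "i \<in> I" for i
      using walk_disp[OF u0 that] yS IS that by auto
    show "?y1 $ i \<ge> int steer_bound" if "i \<notin> I" for i using us(3)[OF that] .
    show "(?y1 - disp \<alpha> (vs @ 0 # us)) $ i \<ge> int steer_bound" if "i \<notin> I" for i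
      using vs'(3)[OF that] unfolding dvs by simp
  qed
  then obtain ws where ws: "disp \<alpha> ws = - disp \<alpha> (vs @ 0 # us)" "exec \<alpha> ?y1 ws" by blast
  have "?y1 + disp \<alpha> ws = y - disp \<alpha> vs" unfolding ws(1) by simp
  then show ?thesis using ws us(2) evs y0
    by (intro exI[of _ "us @ ws @ vs"]) (auto simp: exec_append add.assoc)
qed

end

section \<open>The bound\<close>

lemma power_Suc_tangent: "d ^ Suc k + Suc k * d ^ k \<le> (d + 1 :: nat) ^ Suc k"
proof (induction k)
  case (Suc k)
  have "d ^ Suc (Suc k) + Suc (Suc k) * d ^ Suc k \<le> (d + 1) * (d ^ Suc k + Suc k * d ^ k)"
    by (simp add: algebra_simps)
  also have "\<dots> \<le> (d + 1) * (d + 1) ^ Suc k" using Suc by (rule mult_le_mono2)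
  finally show ?case by simp
qed simp

text \<open>The case \<open>d = 1\<close> fails, with 16 against 15. From \<open>d\<close> to
  \<open>d + 1\<close> the left side grows by the factor \<open>2 * (d + 2)\<close>, and the tangent
  inequality shows that the right side grows at least as much.\<close>

lemma exponent_bound:
  assumes "d \<ge> 2"
  shows "4 * 2 ^ d * fact (d + 1) \<le> (15 * d ^ (d + 2) :: nat)"
  using assms
proof (induction d rule: nat_induct_at_least)
  case base
  then show ?case by (simp add: fact_numeral eval_nat_numeral)
next
  case (Suc d)
  have "2 * (d + 2) * d ^ (d + 2) \<le> (2 * (d + 1) * (d + 1)) * d ^ (d + 1)"
    by (simp add: algebra_simps)
  also have "\<dots> = (d + 1) * (d ^ Suc (d + 1) + Suc (d + 1) * d ^ (d + 1))"
    by (simp add: algebra_simps)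
  also have "\<dots> \<le> (d + 1) * (d + 1) ^ Suc (d + 1)"
    by (intro mult_le_mono2 power_Suc_tangent)
  finally have *: "2 * (d + 2) * d ^ (d + 2) \<le> (d + 1) ^ (d + 3)" by (simp add: eval_nat_numeral)
  have "4 * 2 ^ Suc d * fact (Suc d + 1) = 2 * (d + 2) * (4 * 2 ^ d * fact (d + 1) :: nat)"
    by (simp add: algebra_simps)
  also have "\<dots> \<le> 2 * (d + 2) * (15 * d ^ (d + 2))" using Suc.IH by (rule mult_le_mono2)
  also have "\<dots> \<le> 15 * (d + 1) ^ (d + 3)" using * by simp
  finally show ?case by (simp add: eval_nat_numeral)
qed

lemma fact_prod: "fact p * (p + 1) * (\<Prod>j=1..k. p + 1 + j) = (fact (p + 1 + k) :: nat)"
proof (induction k)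
  case (Suc k)
  have "(\<Prod>j=1..Suc k. p + 1 + j) = (\<Prod>j=1..k. p + 1 + j) * (p + 1 + Suc k)" by simp
  then have "fact p * (p + 1) * (\<Prod>j=1..Suc k. p + 1 + j) =
    fact p * (p + 1) * (\<Prod>j=1..k. p + 1 + j) * (p + 1 + Suc k)" by (simp only: mult.assoc)
  also have "\<dots> = fact (p + 1 + k) * (p + 1 + Suc k)" by (simp only: Suc)
  also have "\<dots> = fact (p + 1 + Suc k)" by (simp add: algebra_simps)
  finally show ?case .
qed simp

text \<open>This is the growth exponent from one threshold to the next: the first factor comes from
  the target height of the pumping, the product from the recursion of \<open>escape_bound\<close>.
  For \<open>d = 1\<close> the values are 10 and 15.\<close>

lemma level_exponent:
  assumes "p < d"
  shows "(1 + 2 * (2 * p + 1) * 2 ^ d) * (\<Prod>j=1..d - p. p + 1 + j) \<le> (15 * d ^ (d + 2) :: nat)"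
proof (cases "d = 1")
  case True
  then show ?thesis using assms by simp
next
  case False
  then have d: "d \<ge> 2" using assms by linarith
  have "1 + 2 * (2 * p + 1) * 2 ^ d \<le> 4 * 2 ^ d * (p + 1 :: nat)" by (simp add: algebra_simps)
  then have "(1 + 2 * (2 * p + 1) * 2 ^ d) * (\<Prod>j=1..d - p. p + 1 + j) \<le>
    4 * 2 ^ d * (p + 1) * (\<Prod>j=1..d - p. p + 1 + j)" by (rule mult_le_mono1)
  also have "\<dots> \<le> 4 * 2 ^ d * (fact p * (p + 1) * (\<Prod>j=1..d - p. p + 1 + j))"
  proof -
    have "1 * ((p + 1) * (\<Prod>j=1..d - p. p + 1 + j)) \<le> fact p * ((p + 1) * (\<Prod>j=1..d - p. p + 1 + j))"
      by (intro mult_le_mono1 fact_ge_1)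
    from mult_le_mono2[OF this, of "4 * 2 ^ d"] show ?thesis by (simp only: mult.assoc mult_1_left)
  qed
  also have "\<dots> = 4 * 2 ^ d * fact (d + 1)" unfolding fact_prod using assms by simp
  also have "\<dots> \<le> 15 * d ^ (d + 2)" using d by (rule exponent_bound)
  finally show ?thesis .
qed

text \<open>If \<open>Y\<close> bounds the previous value and \<open>s = p + Suc k\<close>, each of
  the three summands is at most \<open>m * Y ^ s\<close>, and \<open>3 * m \<le> Y\<close> yields
  \<open>Y ^ (s + 1)\<close>. So the exponent is multiplied by \<open>p + 1 + Suc k\<close>.\<close>

lemma escape_bound_le:
  assumes m: "m \<ge> 1" "3 * m \<le> l" and H: "H + m \<le> l ^ h" and h: "h \<ge> 1"
  shows "escape_bound m p H k + m \<le> l ^ (h * (\<Prod>j=1..k. p + 1 + j))"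
proof (induction k)
  case 0
  then show ?case using H by simp
next
  case (Suc k)
  define e where "e = h * (\<Prod>j=1..k. p + 1 + j)"
  define Y where "Y = l ^ e"
  let ?X = "escape_bound m p H k"
  let ?s = "p + Suc k"
  have "e \<ge> 1" unfolding e_def using h by (simp add: Suc_le_eq prod_pos)
  moreover have l: "l \<ge> 1" using m by linarith
  ultimately have lY: "l \<le> Y" unfolding Y_def by (metis power_increasing power_one_right)
  have X: "?X \<le> Y" using Suc unfolding Y_def e_def by simp
  have Y1: "Y \<ge> 1" using l lY by linarith
  have Ys: "Y \<le> Y ^ ?s" "1 \<le> Y ^ ?s" using Y1 by (auto simp: self_le_power)
  have "?X + m * ?X ^ ?s + m \<le> Y ^ ?s + m * Y ^ ?s + m * Y ^ ?s"
    using order_trans[OF X Ys(1)] X Ys(2) by (intro add_mono mult_le_mono2 power_mono) auto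
  also have "\<dots> \<le> 3 * m * Y ^ ?s" using m(1) by simp
  also have "\<dots> \<le> Y * Y ^ ?s" using m lY by (intro mult_le_mono1) linarith
  also have "\<dots> = l ^ (e * (p + 1 + Suc k))" unfolding Y_def by (simp add: power_add power_mult[symmetric] distrib_left)
  also have "e * (p + 1 + Suc k) = h * (\<Prod>j=1..Suc k. p + 1 + j)"
  proof -
    have "(\<Prod>j=1..Suc k. p + 1 + j) = (\<Prod>j=1..k. p + 1 + j) * (p + 1 + Suc k)" by simp
    then show ?thesis unfolding e_def by (simp only: mult.assoc)
  qed
  finally show ?case by simp
qed

lemma (in projected_run) pump_bound_le:
  assumes m: "m \<ge> 1" and b: "102 * m \<le> b" and I: "card I < CARD('d)"
  shows "pump_bound + m \<le> b ^ (15 * CARD('d) ^ (CARD('d) + 2))"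
proof -
  define d where "d = CARD('d)"
  define p where "p = card I"
  define G1 where "G1 = group_bound (5 * m * N\<^sup>2) d"
  define G2 where "G2 = group_bound (m * (2 * N + 1)) d"
  \<comment> \<open>A common bound for both uses of \<open>group_bound\<close>: it dominates
    \<open>F\<close> and the group factor in \<open>steer_bound\<close>, whence
    \<open>steer_bound \<le> Z\<^sup>2\<close>.\<close>
  define Z where "Z = (15 * m * N\<^sup>2) ^ (2 ^ d)"
  have NN: "N \<le> N\<^sup>2" using N_pos by (simp add: power2_eq_square)
  have "1 \<le> m * N\<^sup>2" using m N_pos by (simp add: Suc_le_eq)
  have "3 * (5 * m * N\<^sup>2) * G1 \<le> (3 * (5 * m * N\<^sup>2)) ^ (2 ^ d)"
    unfolding G1_def using \<open>1 \<le> m * N\<^sup>2\<close> by (intro group_bound_le) simp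
  then have G1: "15 * m * N\<^sup>2 * G1 \<le> Z" unfolding Z_def by (simp add: mult.assoc)
  have "F = 5 * N\<^sup>2 * G1" unfolding F_def G1_def d_def ..
  also have "\<dots> \<le> 15 * m * N\<^sup>2 * G1" using m by (intro mult_le_mono1) simp
  finally have FZ: "F \<le> Z" using G1 by linarith
  have "3 * (m * (2 * N + 1)) * G2 \<le> (3 * (m * (2 * N + 1))) ^ (2 ^ d)"
    unfolding G2_def using m by (intro group_bound_le) simp
  also have "\<dots> \<le> Z" unfolding Z_def
  proof (rule power_mono)
    have "3 * (2 * u + 1) \<le> 15 * v" if "u \<le> v" "1 \<le> u" for u v :: nat using that by simp
    from this[OF NN N_pos] have "3 * (2 * N + 1) \<le> 15 * N\<^sup>2" .
    then have "m * (3 * (2 * N + 1)) \<le> m * (15 * N\<^sup>2)" by (rule mult_le_mono2)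
    then show "3 * (m * (2 * N + 1)) \<le> 15 * m * N\<^sup>2" by (simp only: ac_simps)
  qed simp
  finally have G2: "3 * (m * (2 * N + 1)) * G2 \<le> Z" .
  have "1 \<le> G1" unfolding G1_def by (rule group_bound_pos)
  then have "5 * N\<^sup>2 \<le> F" unfolding \<open>F = 5 * N\<^sup>2 * G1\<close> by simp
  then have NF: "N \<le> N * F" using N_pos NN by simp
  have FNF: "F \<le> N * F" using N_pos by simp
  have "L \<le> 3 * N * F" unfolding L_def mult.assoc using NF FNF by linarith
  then have "steer_bound \<le> m * (G2 * (3 * N * F))"
    unfolding steer_bound_def G2_def[unfolded d_def, symmetric] by (intro mult_le_mono2)
  also have "\<dots> = 3 * (m * N) * G2 * F" by (simp only: ac_simps)
  also have "\<dots> \<le> 3 * (m * (2 * N + 1)) * G2 * F" by (intro mult_le_mono1 mult_le_mono2) simp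
  also have "\<dots> \<le> Z * Z" using G2 FZ by (rule mult_le_mono)
  finally have st: "steer_bound \<le> Z\<^sup>2" by (simp add: power2_eq_square)
  have Q15: "15 * m * N\<^sup>2 \<le> Z" unfolding Z_def using \<open>1 \<le> m * N\<^sup>2\<close> by (intro self_le_power) auto
  have "m * N \<le> m * N\<^sup>2" using NN by (rule mult_le_mono2)
  moreover have "m * 1 \<le> m * N" using N_pos by (rule mult_le_mono2)
  ultimately have mN: "m * N + m \<le> Z" using Q15 unfolding mult.assoc by linarith
  have Z15: "15 \<le> Z" using Q15 \<open>1 \<le> m * N\<^sup>2\<close> by linarith
  have b4: "b \<ge> 4" using b m by linarith
  have ZZ: "Z \<le> Z\<^sup>2" by (simp add: power2_eq_square)
  have "steer_bound + m * N + b + m \<le> 2 * Z\<^sup>2 + b" using st mN ZZ by linarith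
  also have "\<dots> \<le> b * Z\<^sup>2"
  proof -
    obtain b' where b': "b = b' + 4" using b4 by (metis le_add_diff_inverse2)
    have "Z\<^sup>2 \<ge> 15" using Z15 ZZ by linarith
    moreover from this have "b' \<le> b' * Z\<^sup>2" by simp
    ultimately show ?thesis unfolding b' add_mult_distrib by linarith
  qed
  also have "\<dots> \<le> b ^ (1 + 2 * (2 * p + 1) * 2 ^ d)"
  proof -
    \<comment> \<open>The constant and \<open>m\<close> are absorbed into one factor
      \<open>b\<close>; with \<open>N = b ^ p\<close> only a power of \<open>b\<close>
      remains.\<close>
    have "15 * m * N\<^sup>2 \<le> b * N\<^sup>2" using b by (intro mult_le_mono1) simp
    also have "\<dots> = b ^ (2 * p + 1)" unfolding p_def by (simp add: power_mult[symmetric] mult.commute)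
    finally have "Z \<le> (b ^ (2 * p + 1)) ^ (2 ^ d)" unfolding Z_def by (intro power_mono) auto
    then have "Z\<^sup>2 \<le> ((b ^ (2 * p + 1)) ^ (2 ^ d))\<^sup>2" by (intro power_mono) auto
    also have "\<dots> = b ^ (2 * (2 * p + 1) * 2 ^ d)" unfolding power_mult[symmetric] by (simp add: ac_simps)
    finally show ?thesis by simp
  qed
  finally have H: "steer_bound + m * N + b + m \<le> b ^ (1 + 2 * (2 * p + 1) * 2 ^ d)" .
  have "pump_bound + m \<le> b ^ ((1 + 2 * (2 * p + 1) * 2 ^ d) * (\<Prod>j=1..d - p. p + 1 + j))"
    unfolding pump_bound_def p_def[symmetric] d_def[symmetric]
    using escape_bound_le[OF m _ H[unfolded p_def], of p "d - p"] b by (simp add: p_def)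
  also have "\<dots> \<le> b ^ (15 * d ^ (d + 2))"
    using b4 I unfolding d_def[symmetric] p_def[symmetric]
    by (intro power_increasing level_exponent) auto
  finally show ?thesis unfolding d_def .
qed

section \<open>Translation between runs of the VAS and words of times\<close>

lemma int_vec_inject [simp]: "int_vec y = int_vec z \<longleftrightarrow> y = z"
  by (simp add: int_vec_def vec_eq_iff)

lemma run_Nil: "run y [] y"
  by (auto simp: run_def)

lemma run_Cons:
  assumes "int_vec y' = int_vec y + v" "run y' \<sigma> z"
  shows "run y (v # \<sigma>) z"
proof -
  obtain cs where cs: "cs 0 = y'" "cs (length \<sigma>) = z"
    "\<forall>j<length \<sigma>. int_vec (cs (Suc j)) = int_vec (cs j) + \<sigma> ! j"
    using assms(2) unfolding run_def by blast
  show ?thesis unfolding run_def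
  proof (intro exI[of _ "case_nat y cs"] conjI allI impI)
    fix j assume "j < length (v # \<sigma>)"
    then show "int_vec (case_nat y cs (Suc j)) = int_vec (case_nat y cs j) + (v # \<sigma>) ! j"
      using cs assms(1) by (cases j) auto
  qed (use cs in auto)
qed

lemma exec_run:
  assumes "exec \<alpha> (int_vec y) ts" "int_vec z = int_vec y + disp \<alpha> ts"
  shows "run y (map \<alpha> ts) z"
  using assms
proof (induction ts arbitrary: y)
  case Nil
  then show ?case by (simp add: run_Nil)
next
  case (Cons t ts)
  define y' where "y' = (\<chi> i. nat ((int_vec y + \<alpha> t) $ i))"
  have "0 \<le> (int_vec y + \<alpha> t) $ i" for i using Cons.prems(1) exec_nonneg by fastforce
  then have y': "int_vec y' = int_vec y + \<alpha> t" by (simp add: y'_def int_vec_def vec_eq_iff)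
  show ?case using Cons y' by (auto intro!: run_Cons[OF y'] simp: add.assoc)
qed

lemma abs_action_le:
  assumes "finite A" "v \<in> A"
  shows "\<bar>v $ i\<bar> \<le> int (vas_norm A)"
proof -
  have "nat \<bar>v $ i\<bar> \<le> action_norm v" unfolding action_norm_def by (intro Max_ge) auto
  also have "\<dots> \<le> vas_norm A" using assms unfolding vas_norm_def by auto
  finally show ?thesis by linarith
qed

text \<open>Repeat the cycle with its length as period, indexing by \<open>t mod n\<close>, so that
  time 0 is at \<open>c\<close> and fires \<open>a\<close>.\<close>

lemma D_set_cyclic_run:
  assumes "finite A" "a \<in> A" "c \<in> D_set A a"
  obtains x \<alpha> n where "cyclic_run x \<alpha> n (vas_norm A)" "x 0 = int_vec c" "\<alpha> 0 = a" "range \<alpha> \<subseteq> A"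
proof -
  obtain c' \<sigma>' where r: "\<sigma>' \<in> lists A" "run c [a] c'" "run c' \<sigma>' c"
    using assms(3) unfolding D_set_def by blast
  have "int_vec c' = int_vec c + a" using r(2) unfolding run_def by auto
  then have "run c (a # \<sigma>') c" using r(3) by (rule run_Cons)
  then obtain cs where cs: "cs 0 = c" "cs (length (a # \<sigma>')) = c"
    "\<forall>j<length (a # \<sigma>'). int_vec (cs (Suc j)) = int_vec (cs j) + (a # \<sigma>') ! j"
    unfolding run_def by blast
  define n where "n = int (length (a # \<sigma>'))"
  define x where "x t = int_vec (cs (nat (t mod n)))" for t
  define \<alpha> where "\<alpha> t = (a # \<sigma>') ! nat (t mod n)" for t
  have n: "n > 0" unfolding n_def by simp
  have idx: "nat (t mod n) < length (a # \<sigma>')" for t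
    using pos_mod_bound[OF n, of t] pos_mod_sign[OF n, of t] unfolding n_def by linarith
  have \<alpha>A: "\<alpha> t \<in> A" for t
  proof -
    have "\<alpha> t \<in> set (a # \<sigma>')" unfolding \<alpha>_def using idx nth_mem by blast
    then show ?thesis using assms(2) r(1) by auto
  qed
  have "cyclic_run x \<alpha> n (vas_norm A)"
  proof
    fix t i
    have "x (t + 1) = int_vec (cs (Suc (nat (t mod n))))"
    \<comment> \<open>At the wrap-around the next index is 0 instead of the length of the word, but
      \<open>cs\<close> takes the value \<open>c\<close> at both.\<close>
    proof (cases "t mod n + 1 = n")
      case True
      then have "(t + 1) mod n = 0" by (metis mod_add_left_eq mod_self)
      moreover have "Suc (nat (t mod n)) = length (a # \<sigma>')"
        using True pos_mod_sign[OF n, of t] unfolding n_def by linarith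
      ultimately show ?thesis unfolding x_def using cs(1,2) by simp
    next
      case False
      then have "(t + 1) mod n = t mod n + 1"
        using pos_mod_bound[OF n, of t] pos_mod_sign[OF n, of t]
        by (smt (verit) mod_add_left_eq mod_pos_pos_trivial)
      then show ?thesis unfolding x_def using pos_mod_sign[OF n, of t] by (simp add: nat_add_distrib)
    qed
    then show "x (t + 1) = x t + \<alpha> t" using cs(3) idx[of t] unfolding x_def \<alpha>_def by simp
    show "x (t + n) = x t" unfolding x_def by simp
    show "0 \<le> x t $ i" unfolding x_def int_vec_def by simp
    show "\<bar>\<alpha> t $ i\<bar> \<le> int (vas_norm A)" using abs_action_le[OF assms(1) \<alpha>A] .
  qed (rule n)
  moreover have "x 0 = int_vec c" "\<alpha> 0 = a" unfolding x_def \<alpha>_def using cs(1) by simp_all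
  ultimately show ?thesis using that \<alpha>A by blast
qed

lemma D_setI:
  assumes "exec \<alpha> (int_vec c) (t # ts)" "disp \<alpha> (t # ts) = 0" "range \<alpha> \<subseteq> A"
  shows "c \<in> D_set A (\<alpha> t)"
proof -
  define c' where "c' = (\<chi> i. nat ((int_vec c + \<alpha> t) $ i))"
  have e: "exec \<alpha> (int_vec c + \<alpha> t) ts" using assms(1) by simp
  have c': "int_vec c' = int_vec c + \<alpha> t"
    using exec_nonneg[OF e] by (simp add: c'_def int_vec_def vec_eq_iff)
  have "run c' (map \<alpha> ts) c"
  proof (rule exec_run)
    show "exec \<alpha> (int_vec c') ts" using e c' by simp
    show "int_vec c = int_vec c' + disp \<alpha> ts" using assms(2) c' by (simp add: add.assoc)
  qed
  moreover have "run c [\<alpha> t] c'" using c' run_Nil by (rule run_Cons)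
  moreover have "map \<alpha> ts \<in> lists A" using assms(3) by (auto simp: image_subset_iff)
  ultimately show ?thesis unfolding D_set_def by blast
qed

lemma config_norm_le: "(\<And>i. c $ i \<le> M) \<Longrightarrow> config_norm c \<le> M"
  unfolding config_norm_def by (subst Max_le_iff) auto

theorem theorem11p1:
  fixes A :: "(int ^ 'd) set" and a :: "int ^ 'd" and c :: "nat ^ 'd" and d :: nat
  defines "d \<equiv> CARD('d)"
  assumes "finite A"
    and "a \<in> A"
    and "minimal_in (D_set A a) c"
  shows "config_norm c \<le> (102 * d ^ 2 * vas_norm A ^ 2) ^ ((15 * d ^ (d + 2)) ^ (d + 2))"
\<comment> \<open>If all actions are zero, the zero configuration lies in \<open>D_set A a\<close>,
  so \<open>c\<close> is zero. The thresholds in the other case need a positive base.\<close>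
proof (cases "vas_norm A = 0")
  case True
  then have "a = 0" using abs_action_le[OF assms(2,3)] by (simp add: vec_eq_iff)
  then have "0 \<in> D_set A a"
    unfolding D_set_def by (intro CollectI exI[of _ 0] bexI[of _ "[]"] conjI run_Cons[OF _ run_Nil])
      (auto simp: run_Nil)
  moreover have "0 \<le> c" by (simp add: less_eq_vec_def)
  ultimately have "c = 0" using assms(4) unfolding minimal_in_def by blast
  then show ?thesis using config_norm_le[of c 0] by simp
next
  case False
  define m where "m = vas_norm A"
  define B where "B = 102 * d ^ 2 * m ^ 2"
  define E where "E = 15 * d ^ (d + 2)"
  \<comment> \<open>Thresholds with \<open>b (Suc p) = b p ^ E\<close>, the growth granted by
    \<open>pump_bound_le\<close>. The last one, \<open>b d\<close>, has exponent
    \<open>E ^ (d + 1)\<close>, within the claimed \<open>E ^ (d + 2)\<close>.\<close>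
  define b where "b p = B ^ (E ^ (p + 1))" for p
  have m: "m \<ge> 1" using False m_def by simp
  have d: "d \<ge> 1" unfolding d_def by (simp add: Suc_le_eq)
  have "m \<le> m ^ 2" by (simp add: power2_eq_square)
  also have "\<dots> \<le> d ^ 2 * m ^ 2" using d by simp
  finally have Bm: "102 * m \<le> B" unfolding B_def by simp
  have B1: "B \<ge> 1" using Bm m by linarith
  have E1: "E \<ge> 1" unfolding E_def using d by (simp add: Suc_le_eq)
  have b_mono: "b p \<le> b q" if "p \<le> q" for p q
    unfolding b_def using that B1 E1 by (intro power_increasing) auto
  have Bb: "B \<le> b p" for p
  proof -
    have "B ^ 1 \<le> B ^ (E ^ (p + 1))" using B1 E1 by (intro power_increasing) auto
    then show ?thesis unfolding b_def by simp
  qed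
  have b_Suc: "b (Suc p) = b p ^ E" for p
    unfolding b_def by (simp add: power_mult[symmetric] ac_simps)
  have b_final: "b d \<le> B ^ (E ^ (d + 2))"
    unfolding b_def using B1 E1 by (intro power_increasing) auto
  have c: "c \<in> D_set A a" "\<And>y. y \<in> D_set A a \<Longrightarrow> y \<le> c \<Longrightarrow> y = c"
    using assms(4) unfolding minimal_in_def by auto
  obtain x \<alpha> n where x: "cyclic_run x \<alpha> n m" "x 0 = int_vec c" "\<alpha> 0 = a" "range \<alpha> \<subseteq> A"
    using D_set_cyclic_run[OF assms(2,3) c(1)] unfolding m_def by blast
  \<comment> \<open>The threshold depends on the size of \<open>J\<close>. As \<open>P {}\<close>
    holds vacuously and sizes are at most \<open>d\<close>, a set \<open>I\<close> of largest size
    exists.\<close>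
  define P where "P J \<longleftrightarrow> (\<forall>t. \<forall>i\<in>J. x t $ i < int (b (card J)))" for J
  have "\<exists>I. P I \<and> (\<forall>J. P J \<longrightarrow> card J \<le> card I)"
    by (rule ex_has_greatest_nat[of P "{}" card "d + 1"])
      (auto simp: P_def d_def less_Suc_eq_le card_mono)
  then obtain I where I: "P I" "\<And>J. P J \<Longrightarrow> card J \<le> card I" by blast
  define p where "p = card I"
  have "c $ i \<le> b d" for i
  proof (cases "I = UNIV")
    case True
    then have "x 0 $ i < int (b d)" using I(1) unfolding P_def d_def by auto
    then show ?thesis unfolding x(2) int_vec_def by simp
  next
    case False
    then have pd: "p < d" unfolding p_def d_def by (simp add: psubset_card_mono psubsetI)
    interpret projected_run x \<alpha> n m I "b p"
      using x(1) I(1) by (auto simp: projected_run_def projected_run_axioms_def P_def p_def)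
    have "102 * m \<le> b p" using Bm Bb[of p] by linarith
    then have bound: "pump_bound + m \<le> b (Suc p)"
      using pump_bound_le[OF m] pd unfolding b_Suc E_def d_def p_def by simp
    have far: "\<exists>t. x t $ i \<ge> int (pump_bound + m)" if i: "i \<notin> I" for i
    proof -
      have card: "card (insert i I) = Suc p" using i unfolding p_def by simp
      \<comment> \<open>By maximality some coordinate of \<open>insert i I\<close> reaches the next
        threshold; those in \<open>I\<close> stay below \<open>b p\<close>, so it is
        \<open>i\<close>.\<close>
      then have "\<not> P (insert i I)" using I(2)[of "insert i I"] unfolding p_def by auto
      then obtain t j where j: "j \<in> insert i I" "x t $ j \<ge> int (b (Suc p))"
        unfolding P_def card by (auto simp: not_less)
      have "j \<notin> I" using bounded[of j t] j(2) b_mono[of p "Suc p"] by fastforce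
      then show ?thesis using j bound by (intro exI[of _ t]) auto
    qed
    define c' where "c' = (\<chi> i. min (c $ i) (pump_bound + m))"
    obtain ts where ts: "exec \<alpha> (int_vec c') (0 # ts)" "disp \<alpha> (0 # ts) = 0"
      using cycle_from_truncation[OF far, of "int_vec c'"] x(2)
      by (auto simp: int_vec_def c'_def of_nat_min simp del: exec.simps disp_simps)
    then have "c' \<in> D_set A a" using D_setI[OF ts x(4)] x(3) by simp
    moreover have "c' \<le> c" by (simp add: c'_def less_eq_vec_def)
    ultimately have "c' = c" using c(2) by blast
    then have "c $ i \<le> pump_bound + m" unfolding c'_def by (metis min.cobounded2 vec_lambda_beta)
    also have "\<dots> \<le> b d" using bound b_mono[of "Suc p" d] pd by linarith
    finally show ?thesis .
  qed
  then have "config_norm c \<le> b d" by (rule config_norm_le)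
  then show ?thesis using b_final unfolding B_def E_def m_def by linarith
qed

end
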